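(* For every $1\leq k\leq 4$, every $k$-icube in $\mathbb{Z}[i]^4$ can be extended to a $4$-icube (of the same norm).
   Context: For $1\leq k\leq n$, a matrix $(v_1|\dotsc|v_k)\in\mathbb{Z}[i]^{n\times k}$ is a $k$-icube in $\mathbb{Z}[i]^n$ of norm $\lambda>0$ if $v_i^*v_j=\lambda$ for $i=j$ and $v_i^*v_j=0$ for $i\neq j$, where $v^*=\overline{v}^T$. An $\ell$-icube $A$ can be extended to a $k$-icube ($\ell<k$) if some $\ell$ columns of some $k$-icube form $A$. *)

theory Defs
  imports Complex_Main
begin

definition gauss_int :: "complex \<Rightarrow> bool" where
  "gauss_int z \<longleftrightarrow> Re z \<in> \<int> \<and> Im z \<in> \<int>"

definition hprod :: "complex list \<Rightarrow> complex list \<Rightarrow> complex" where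
  "hprod v w = (\<Sum>i<length v. cnj (v ! i) * w ! i)"

text \<open>A k-icube in Z[i]^n of norm lam: the list of its k columns v_1..v_k,
  each a vector of length n with Gaussian integer entries.\<close>
definition icube :: "nat \<Rightarrow> nat \<Rightarrow> real \<Rightarrow> complex list list \<Rightarrow> bool" where
  "icube n k lam vs \<longleftrightarrow>
     1 \<le> k \<and> k \<le> n \<and> lam > 0 \<and> length vs = k \<and>
     (\<forall>v\<in>set vs. length v = n \<and> (\<forall>x\<in>set v. gauss_int x)) \<and>
     (\<forall>i<k. \<forall>j<k. hprod (vs ! i) (vs ! j) = (if i = j then complex_of_real lam else 0))"

definition extends_to :: "nat \<Rightarrow> nat \<Rightarrow> real \<Rightarrow> complex list list \<Rightarrow> bool" where
  "extends_to n k lam A \<longleftrightarrow>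
     (\<exists>B. icube n k lam B \<and>
        (\<exists>\<sigma>. inj_on \<sigma> {..<length A} \<and> \<sigma> ` {..<length A} \<subseteq> {..<k} \<and>
              (\<forall>i<length A. B ! (\<sigma> i) = A ! i)))"

end

theory Submission
  imports Defs "HOL-Analysis.Determinants" "HOL-Computational_Algebra.Primes"
begin

text \<open>A single vector (a, b, c, d) is completed to a 2-icube by (-b*, a*, -d*, c*), where * is conjugation.
  For k = 2, 3 let K be the lattice of Gaussian integer vectors orthogonal to the icube of norm lam, and let
  H be the Gram matrix of a basis of K. The map lam - V V* sends every integral vector into K, which
  forces G = lam H^(-1) to be integral. If G = C C* with C integral, then C* H C = lam, so C turns the
  basis of K into the missing columns.

  For k = 3, G is an integer and a quotient of two norms from Q(i), hence a norm. For k = 2, G is a positive binary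
  Hermitian form whose determinant is a norm. Such a form is of the shape C C*: passing to
  integral overlattices and using Lagrange's four-square theorem reduces this to determinant 1,
  where Hermite reduction yields the identity matrix.\<close>

section \<open>Gaussian integers\<close>

text \<open>The map in question is lam times the orthogonal projection onto the complement, so G is
  the Gram matrix of the dual of K, rescaled by lam. Its determinant is found by a volume count. The
  icube spans a lattice of Gram determinant lam^k; triangularising it by unimodular row operations
  shows that this is |s|^2 times the Gram determinant of its primitive closure, where s is the
  product of the diagonal entries. The primitive closure and K have equal Gram determinants, so det
  H = lam^k / |s|^2. This gives det G = |s|^2 for k = 2 and G = |s|^2 / lam^2 for k = 3. That the
  determinant is a norm is clearly necessary for a factorisation; the difficulty is sufficiency for
  k = 2. Adjoining a vector divides the determinant by a norm, but the natural candidates already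
  lie in the lattice when s divides the whole form. In this stalled case s and its conjugate are
  associated, so s is a rational integer up to a unit and possibly a factor 1 + i. Only the integer
  case calls for four squares.\<close>

lemma gauss_int_iff: "gauss_int z \<longleftrightarrow> (\<exists>a b::int. z = Complex (of_int a) (of_int b))"
  by (auto simp: gauss_int_def Ints_def complex_eq_iff)

lemma gauss_int_0 [simp]: "gauss_int 0"
  and gauss_int_1 [simp]: "gauss_int 1"
  and gauss_int_ii [simp]: "gauss_int \<i>"
  and gauss_int_of_int [simp]: "gauss_int (of_int k)"
  and gauss_int_of_nat [simp]: "gauss_int (of_nat m)"
  by (simp_all add: gauss_int_def)

lemma gauss_int_add [simp]: "gauss_int x \<Longrightarrow> gauss_int y \<Longrightarrow> gauss_int (x + y)"
  and gauss_int_diff [simp]: "gauss_int x \<Longrightarrow> gauss_int y \<Longrightarrow> gauss_int (x - y)"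
  and gauss_int_minus [simp]: "gauss_int x \<Longrightarrow> gauss_int (- x)"
  and gauss_int_mult [simp]: "gauss_int x \<Longrightarrow> gauss_int y \<Longrightarrow> gauss_int (x * y)"
  and gauss_int_cnj [simp]: "gauss_int x \<Longrightarrow> gauss_int (cnj x)"
  by (simp_all add: gauss_int_def)

lemma gauss_int_sum: "(\<And>i. i \<in> S \<Longrightarrow> gauss_int (f i)) \<Longrightarrow> gauss_int (sum f S)"
  by (induction S rule: infinite_finite_induct) auto

lemma gauss_int_prod: "(\<And>i. i \<in> S \<Longrightarrow> gauss_int (f i)) \<Longrightarrow> gauss_int (prod f S)"
  by (induction S rule: infinite_finite_induct) auto

lemma gauss_int_real_is_int:
  assumes "gauss_int z" "cnj z = z"
  obtains k :: int where "z = of_int k"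
  using assms by (auto simp: gauss_int_iff complex_eq_iff)

text \<open>Valued in the natural numbers so that it can be minimised and used as an induction
  measure; on Gaussian integers the floor changes nothing.\<close>

definition gnorm :: "complex \<Rightarrow> nat" where
  "gnorm z = nat \<lfloor>(cmod z)\<^sup>2\<rfloor>"

lemma of_nat_gnorm:
  assumes "gauss_int z"
  shows "of_nat (gnorm z) = z * cnj z"
proof -
  obtain a b :: int where z: "z = Complex (of_int a) (of_int b)"
    using assms by (auto simp: gauss_int_iff)
  have "(cmod z)\<^sup>2 = of_int (a\<^sup>2 + b\<^sup>2)"
    by (simp add: z cmod_power2)
  moreover have "real (gnorm z) = (cmod z)\<^sup>2"
    unfolding gnorm_def calculation floor_of_int by simp
  ultimately show ?thesis
    by (metis complex_norm_square of_real_of_nat_eq)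
qed

lemma real_gnorm: "gauss_int z \<Longrightarrow> real (gnorm z) = (cmod z)\<^sup>2"
  using of_nat_gnorm[of z] by (metis complex_norm_square of_real_eq_iff of_real_of_nat_eq)

lemma gnorm_eq_0_iff: "gauss_int z \<Longrightarrow> gnorm z = 0 \<longleftrightarrow> z = 0"
  using real_gnorm[of z] by auto

lemma gnorm_mult: "gauss_int x \<Longrightarrow> gauss_int y \<Longrightarrow> gnorm (x * y) = gnorm x * gnorm y"
  using real_gnorm[of x] real_gnorm[of y] real_gnorm[of "x * y"]
  by (metis gauss_int_mult norm_mult of_nat_eq_iff of_nat_mult power_mult_distrib)

text \<open>Rounding each coordinate costs at most 1/4. That the total stays below 1 drives both
  Euclidean division and the Hermite reduction of forms.\<close>

lemma gauss_int_nearest: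
  obtains q where "gauss_int q" "(cmod (z - q))\<^sup>2 \<le> 1 / 2"
proof
  let ?q = "Complex (of_int (round (Re z))) (of_int (round (Im z)))"
  show "gauss_int ?q" by (simp add: gauss_int_def)
  have h: "(x - of_int (round x))\<^sup>2 \<le> 1 / 4" for x :: real
  proof -
    have "\<bar>x - of_int (round x)\<bar> \<le> 1 / 2"
      using of_int_round_abs_le[of x] by (simp add: abs_minus_commute)
    then have "\<bar>x - of_int (round x)\<bar>\<^sup>2 \<le> (1 / 2)\<^sup>2"
      by (intro power_mono) auto
    then show ?thesis by (simp add: power2_eq_square)
  qed
  show "(cmod (z - ?q))\<^sup>2 \<le> 1 / 2"
    using h[of "Re z"] h[of "Im z"] by (simp add: cmod_power2)
qed

lemma gauss_int_division:
  assumes "gauss_int x" "gauss_int y" "y \<noteq> 0"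
  obtains q where "gauss_int q" "gnorm (x - q * y) < gnorm y"
proof -
  obtain q where q: "gauss_int q" "(cmod (x / y - q))\<^sup>2 \<le> 1 / 2"
    by (rule gauss_int_nearest)
  have "x - q * y = (x / y - q) * y"
    using assms by (simp add: field_simps)
  then have "(cmod (x - q * y))\<^sup>2 = (cmod (x / y - q))\<^sup>2 * (cmod y)\<^sup>2"
    by (simp add: norm_mult power_mult_distrib)
  also have "\<dots> \<le> 1 / 2 * (cmod y)\<^sup>2"
    using q by (intro mult_right_mono) auto
  also have "\<dots> < (cmod y)\<^sup>2" using assms by simp
  finally have "real (gnorm (x - q * y)) < real (gnorm y)"
    using assms q by (simp add: real_gnorm)
  then show ?thesis using that q by simp
qed

text \<open>A nonzero element of least norm in the ideal generated by \<open>a\<close> and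
  \<open>b\<close> divides all of it. The identity is given for the cofactors, the shape in which it
  yields matrices of determinant 1.\<close>

lemma gauss_int_bezout:
  assumes "gauss_int a" "gauss_int b" "a \<noteq> 0 \<or> b \<noteq> 0"
  obtains g x y a' b' where "gauss_int g" "gauss_int x" "gauss_int y" "gauss_int a'" "gauss_int b'"
    "g \<noteq> 0" "a = g * a'" "b = g * b'" "x * a' + y * b' = 1"
proof -
  define I where "I = {x * a + y * b | x y. gauss_int x \<and> gauss_int y}"
  have Ia: "a \<in> I" unfolding I_def mem_Collect_eq by (rule exI[of _ 1], rule exI[of _ 0]) simp
  have Ib: "b \<in> I" unfolding I_def mem_Collect_eq by (rule exI[of _ 0], rule exI[of _ 1]) simp
  have Ig: "gauss_int z" if "z \<in> I" for z using that assms by (auto simp: I_def)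
  obtain g where g: "g \<in> I" "g \<noteq> 0" and gmin: "\<And>z. z \<in> I \<Longrightarrow> z \<noteq> 0 \<Longrightarrow> gnorm g \<le> gnorm z"
    using ex_has_least_nat[of "\<lambda>z. z \<in> I \<and> z \<noteq> 0" _ gnorm] Ia Ib assms(3) by metis
  obtain x y where xy: "gauss_int x" "gauss_int y" "g = x * a + y * b"
    using g by (auto simp: I_def)
  have div: "\<exists>q. gauss_int q \<and> z = g * q" if z: "z \<in> I" for z
  proof -
    obtain q where q: "gauss_int q" "gnorm (z - q * g) < gnorm g"
      using gauss_int_division[OF Ig[OF z] Ig[OF g(1)] g(2)] .
    obtain u v where uv: "gauss_int u" "gauss_int v" "z = u * a + v * b"
      using z by (auto simp: I_def)
    have "z - q * g \<in> I" unfolding I_def mem_Collect_eq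
      by (rule exI[of _ "u - q * x"], rule exI[of _ "v - q * y"])
        (use uv xy q in \<open>simp add: algebra_simps\<close>)
    then have "z - q * g = 0" using gmin q(2) by fastforce
    then show ?thesis using q(1) by (auto intro!: exI[of _ q])
  qed
  obtain a' b' where ab: "gauss_int a'" "a = g * a'" "gauss_int b'" "b = g * b'"
    using div[OF Ia] div[OF Ib] by blast
  have "g * (x * a' + y * b') = g * 1"
    using xy(3) ab(2,4) by (simp add: algebra_simps)
  then have "x * a' + y * b' = 1" using g(2) by simp
  then show ?thesis using that[of g x y a' b'] Ig[OF g(1)] xy ab g(2) by blast
qed

text \<open>Write u/v in lowest terms; then the denominator divides the conjugate of the numerator, and the
  quotient has norm n.\<close>
lemma norm_quotient_is_norm:
  assumes "gauss_int u" "gauss_int v" "v \<noteq> 0" "gauss_int n" "u * cnj u = n * (v * cnj v)"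
  obtains s where "gauss_int s" "n = s * cnj s"
proof -
  obtain g x y u' v' where b: "gauss_int g" "gauss_int x" "gauss_int y" "gauss_int u'" "gauss_int v'"
    "g \<noteq> 0" "u = g * u'" "v = g * v'" "x * u' + y * v' = 1"
    using gauss_int_bezout[of u v] assms by metis
  have v': "v' \<noteq> 0" using b assms(3) by auto
  have "(g * cnj g) * (u' * cnj u') = (g * cnj g) * (n * (v' * cnj v'))"
    using assms(5) unfolding b(7,8) by (simp add: mult_ac)
  then have n: "u' * cnj u' = n * (v' * cnj v')" using b(6) by simp
  \<comment> \<open>The quotient of \<open>cnj u'\<close> by \<open>v'\<close>: multiply the Bezout
    identity by \<open>cnj u'\<close> and replace \<open>u' * cnj u'\<close> by its multiple of
    \<open>v'\<close>.\<close>
  define w where "w = x * n * cnj v' + y * cnj u'"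
  have "v' * w = x * (n * (v' * cnj v')) + y * v' * cnj u'"
    by (simp add: w_def algebra_simps)
  also have "\<dots> = (x * u' + y * v') * cnj u'"
    unfolding n[symmetric] by (simp add: algebra_simps)
  finally have w: "v' * w = cnj u'" using b(9) by simp
  have "(v' * cnj v') * (w * cnj w) = (v' * w) * cnj (v' * w)" by simp
  also have "\<dots> = (v' * cnj v') * n" unfolding w using n by (simp add: mult_ac)
  finally have "n = w * cnj w" using v' by simp
  moreover have "gauss_int w" using b assms by (simp add: w_def)
  ultimately show ?thesis using that by blast
qed

section \<open>Gram matrices over the Gaussian integers\<close>

definition gmat :: "complex^'n^'m \<Rightarrow> bool" where
  "gmat A \<longleftrightarrow> (\<forall>i j. gauss_int (A $ i $ j))"

definition cadj :: "complex^'n^'m \<Rightarrow> complex^'m^'n" where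
  "cadj A = (\<chi> i j. cnj (A $ j $ i))"

lemma cadj_nth [simp]: "cadj A $ i $ j = cnj (A $ j $ i)"
  by (simp add: cadj_def)

lemma gmat_nth: "gmat A \<Longrightarrow> gauss_int (A $ i $ j)"
  by (simp add: gmat_def)

lemma gmat_mult [simp]: "gmat A \<Longrightarrow> gmat B \<Longrightarrow> gmat (A ** B)"
  by (auto simp: gmat_def matrix_matrix_mult_def intro!: gauss_int_sum)

lemma gmat_cadj [simp]: "gmat A \<Longrightarrow> gmat (cadj A)"
  by (simp add: gmat_def)

lemma gmat_mat_1 [simp]: "gmat (mat 1)"
  by (simp add: gmat_def mat_def)

lemma cadj_mult: "cadj (A ** B) = cadj B ** cadj A"
  by (simp add: vec_eq_iff matrix_matrix_mult_def mult.commute)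

lemma cadj_cadj [simp]: "cadj (cadj A) = A"
  by (simp add: vec_eq_iff)

lemma cadj_mat_1 [simp]: "cadj (mat 1) = mat 1"
  by (simp add: vec_eq_iff mat_def)

lemma gauss_int_det: "gmat A \<Longrightarrow> gauss_int (det A)"
  unfolding det_def
  by (intro gauss_int_sum gauss_int_mult gauss_int_prod) (auto simp: gmat_nth)

lemma det_cadj: "det (cadj A) = cnj (det A)"
proof -
  have "cadj A = transpose (\<chi> i j. cnj (A $ i $ j))"
    by (simp add: vec_eq_iff transpose_def)
  then have "det (cadj A) = det (\<chi> i j. cnj (A $ i $ j))"
    by (simp add: det_transpose)
  also have "\<dots> = cnj (det A)"
    by (simp add: det_def)
  finally show ?thesis .
qed

section \<open>Binary Hermitian forms and their factorisation\<close>

definition mat22 :: "complex \<Rightarrow> complex \<Rightarrow> complex \<Rightarrow> complex \<Rightarrow> complex^2^2" where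
  "mat22 a b c d = vector [vector [a, b], vector [c, d]]"

lemma mat22_nth [simp]:
  "mat22 a b c d $ 1 $ 1 = a" "mat22 a b c d $ 1 $ 2 = b"
  "mat22 a b c d $ 2 $ 1 = c" "mat22 a b c d $ 2 $ 2 = d"
  by (simp_all add: mat22_def)

lemma mat22_eq_iff: "A = mat22 a b c d \<longleftrightarrow> A$1$1 = a \<and> A$1$2 = b \<and> A$2$1 = c \<and> A$2$2 = d"
  by (auto simp: vec_eq_iff forall_2)

lemma mat22_mult:
  "mat22 a b c d ** mat22 e f g h = mat22 (a*e + b*g) (a*f + b*h) (c*e + d*g) (c*f + d*h)"
  by (simp add: mat22_eq_iff matrix_matrix_mult_def sum_2)

lemma cadj_mat22: "cadj (mat22 a b c d) = mat22 (cnj a) (cnj c) (cnj b) (cnj d)"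
  by (simp add: mat22_eq_iff)

lemma mat_1_mat22: "mat 1 = mat22 1 0 0 1"
  by (simp add: mat22_eq_iff mat_def)

lemma gmat_mat22:
  "gmat (mat22 a b c d) \<longleftrightarrow> gauss_int a \<and> gauss_int b \<and> gauss_int c \<and> gauss_int d"
  by (auto simp: gmat_def forall_2)

definition gram_rep :: "complex^2^2 \<Rightarrow> bool" where
  "gram_rep G \<longleftrightarrow> (\<exists>C::complex^2^2. gmat C \<and> G = C ** cadj C)"

lemma gram_rep_conj:
  assumes "gram_rep G" "gmat T"
  shows "gram_rep (T ** G ** cadj T)"
proof -
  obtain C :: "complex^2^2" where "gmat C" "G = C ** cadj C" using assms by (auto simp: gram_rep_def)
  then show ?thesis using assms unfolding gram_rep_def
    by (intro exI[of _ "T ** C"]) (simp add: cadj_mult matrix_mul_assoc)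
qed

text \<open>Only the inverse \<open>T\<close> has to be integral. Hence \<open>P\<close> may have
  denominators, and the lemma covers passing to an overlattice as well as changing the
  basis.\<close>

lemma gram_rep_basis_change:
  assumes "gmat T" "T ** P = mat 1" "gram_rep (P ** G ** cadj P)"
  shows "gram_rep G"
proof -
  have "T ** (P ** G ** cadj P) ** cadj T = (T ** P) ** G ** cadj (T ** P)"
    by (simp add: cadj_mult matrix_mul_assoc)
  then show ?thesis using gram_rep_conj[OF assms(3,1)] by (simp add: assms(2))
qed

lemma gram_rep_swap:
  assumes "gram_rep (mat22 c (cnj b) b a)"
  shows "gram_rep (mat22 a b (cnj b) c)"
  by (rule gram_rep_basis_change[of "mat22 0 1 1 0" "mat22 0 1 1 0"])
    (use assms in \<open>simp_all add: gmat_mat22 mat22_mult cadj_mat22 mat_1_mat22\<close>)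

text \<open>Hermite reduction. Translating the second basis vector makes the off-diagonal entry
  satisfy |d|^2 \<le> a^2 / 2; the new diagonal entry (1 + |d|^2) / a is then smaller than
  \<open>a\<close> once a \<ge> 2. For a = 1 the bound leaves only d = 0, which is the identity
  form.\<close>

lemma gram_rep_unimodular:
  fixes a c :: int
  assumes "a > 0" "gauss_int b" "of_int a * of_int c - b * cnj b = 1"
  shows "gram_rep (mat22 (of_int a) b (cnj b) (of_int c))"
  using assms
proof (induction "nat a" arbitrary: a b c rule: less_induct)
  case less
  let ?G = "mat22 (of_int a) b (cnj b) (of_int c)"
  have a0: "(of_int a :: complex) \<noteq> 0" using less.prems by simp
  obtain q where q: "gauss_int q" "(cmod (b / of_int a - q))\<^sup>2 \<le> 1 / 2"
    by (rule gauss_int_nearest)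
  define d where "d = b - q * of_int a"
  have gd: "gauss_int d" using q less.prems by (simp add: d_def)
  have "d = (b / of_int a - q) * of_int a" using a0 by (simp add: d_def field_simps)
  then have "(cmod d)\<^sup>2 = (cmod (b / of_int a - q))\<^sup>2 * (of_int a)\<^sup>2"
    by (simp add: norm_mult power_mult_distrib)
  also have "\<dots> \<le> 1 / 2 * (of_int a)\<^sup>2"
    using q by (intro mult_right_mono) auto
  finally have dle: "real (gnorm d) \<le> (of_int a)\<^sup>2 / 2" using gd by (simp add: real_gnorm)
  \<comment> \<open>The value of the form at the translated second basis vector.\<close>
  define e :: complex where "e = of_int c - cnj q * b - q * cnj b + q * cnj q * of_int a"
  have "gauss_int e" "cnj e = e" using q less.prems by (simp_all add: e_def algebra_simps)
  then obtain e' where e': "e = of_int e'" by (rule gauss_int_real_is_int)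
  have det: "of_int a * e - d * cnj d = 1"
    using less.prems(3) by (simp add: d_def e_def algebra_simps)
  then have "complex_of_int (a * e') = of_int (1 + int (gnorm d))"
    using of_nat_gnorm[OF gd] by (simp add: e' algebra_simps)
  then have ae: "a * e' = 1 + int (gnorm d)" by (simp only: of_int_eq_iff)
  have e'pos: "e' > 0"
    using ae less.prems(1) by (smt (verit) zero_less_mult_pos of_nat_0_le_iff)
  have "gram_rep (mat22 e (cnj d) d (of_int a))"
  proof (cases "a = 1")
    case True
    then have "gnorm d = 0" using dle by simp
    then have "d = 0" using gd by (simp add: gnorm_eq_0_iff)
    then have "mat22 e (cnj d) d (of_int a) = mat 1 ** cadj (mat 1)"
      using True det by (simp add: mat_1_mat22 cadj_mat22 mat22_mult)
    then show ?thesis unfolding gram_rep_def by (metis gmat_mat_1)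
  next
    case False
    then have a2: "a \<ge> 2" using less.prems by simp
    have "real_of_int (a * e') \<le> 1 + (of_int a)\<^sup>2 / 2"
      using dle unfolding ae by simp
    moreover have "1 + (real_of_int a)\<^sup>2 / 2 < (of_int a)\<^sup>2"
    proof -
      have "(2::real)\<^sup>2 \<le> (of_int a)\<^sup>2" using a2 by (intro power_mono) auto
      then show ?thesis by simp
    qed
    ultimately have "real_of_int (a * e') < of_int (a * a)" by (simp add: power2_eq_square)
    then have "a * e' < a * a" by (simp only: of_int_less_iff)
    then have "e' < a" using less.prems(1) by simp
    then have "gram_rep (mat22 (of_int e') (cnj d) (cnj (cnj d)) (of_int a))"
      using e'pos gd det less.prems by (intro less.hyps) (auto simp: e' mult.commute)
    then show ?thesis by (simp add: e')
  qed
  \<comment> \<open>Translation and swap in one matrix, so that \<open>e\<close> comes first and the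
    induction hypothesis applies.\<close>
  moreover have "mat22 (- cnj q) 1 1 0 ** ?G ** cadj (mat22 (- cnj q) 1 1 0) = mat22 e (cnj d) d (of_int a)"
    by (simp add: mat22_mult cadj_mat22 d_def e_def mat22_eq_iff algebra_simps)
  ultimately show ?case
    using q by - (rule gram_rep_basis_change[of "mat22 0 1 1 (cnj q)" "mat22 (- cnj q) 1 1 0"],
      simp_all add: gmat_mat22 mat22_mult mat_1_mat22)
qed

text \<open>Pigeonhole: for p = 2 m + 1 and arguments 0, ..., m, the residues of x^2 and those of -
  1 - y^2 are m + 1 distinct values each, too many to be disjoint modulo p.\<close>

lemma sum_two_squares_plus_1_cong_0:
  fixes p :: nat
  assumes "prime p"
  obtains x y :: int where "int p dvd x\<^sup>2 + y\<^sup>2 + 1"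
proof (cases "p = 2")
  case True
  then show ?thesis using that[of 1 0] by simp
next
  case False
  then have "odd p" using assms prime_odd_nat[of p] prime_gt_1_nat[of p] by (simp add: le_less_Suc_eq nat_less_le)
  then obtain m where m: "p = 2 * m + 1" by (auto elim: oddE)
  define f where "f x = (int x)\<^sup>2 mod int p" for x
  define g where "g x = (- 1 - (int x)\<^sup>2) mod int p" for x
  have key: "x = y" if "x \<le> m" "y \<le> m" "int p dvd (int x)\<^sup>2 - (int y)\<^sup>2" for x y
  proof -
    have "int p dvd (int x - int y) * (int x + int y)"
      using that(3) by (simp add: power2_eq_square algebra_simps)
    then have "int p dvd int x - int y \<or> int p dvd int x + int y"
      using assms prime_dvd_mult_iff[of "int p"] by simp
    then show ?thesis
    proof
      assume "int p dvd int x - int y"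
      then show ?thesis using that(1,2) m zdvd_imp_le[of "int p" "\<bar>int x - int y\<bar>"]
        by (cases "x = y") auto
    next
      assume "int p dvd int x + int y"
      then show ?thesis using that(1,2) m zdvd_imp_le[of "int p" "int x + int y"]
        by (cases "x = 0 \<and> y = 0") auto
    qed
  qed
  have "inj_on f {..m}"
    unfolding inj_on_def f_def using key by (auto simp: mod_eq_dvd_iff)
  moreover have "inj_on g {..m}"
  proof (rule inj_onI)
    fix x y assume "x \<in> {..m}" "y \<in> {..m}" "g x = g y"
    then show "x = y" using key[of y x] by (auto simp: g_def mod_eq_dvd_iff algebra_simps)
  qed
  ultimately have c: "card (f ` {..m}) = m + 1" "card (g ` {..m}) = m + 1"
    by (simp_all add: card_image)
  have sub: "f ` {..m} \<union> g ` {..m} \<subseteq> {0..<int p}"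
    using m by (auto simp: f_def g_def)
  have "f ` {..m} \<inter> g ` {..m} \<noteq> {}"
  proof
    assume "f ` {..m} \<inter> g ` {..m} = {}"
    then have "card (f ` {..m} \<union> g ` {..m}) = 2 * m + 2"
      using c by (subst card_Un_disjoint) auto
    then show False using card_mono[OF _ sub] m by simp
  qed
  then obtain x y where "f x = g y" by blast
  then have "int p dvd (int x)\<^sup>2 - (- 1 - (int y)\<^sup>2)"
    by (simp add: f_def g_def mod_eq_dvd_iff)
  then show ?thesis using that[of "int x" "int y"] by (simp add: algebra_simps)
qed

text \<open>If p k = x^2 + y^2 + 1, the form with entries p, x + i y, k is unimodular, hence a sum of two
  norms, so p is a sum of four squares.\<close>
lemma gram_rep_scalar_prime:
  assumes "prime p"
  shows "gram_rep (mat22 (of_nat p) 0 0 (of_nat p))"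
proof -
  obtain x y :: int where "int p dvd x\<^sup>2 + y\<^sup>2 + 1"
    using sum_two_squares_plus_1_cong_0[OF assms] .
  then obtain k where k: "x\<^sup>2 + y\<^sup>2 + 1 = int p * k" by auto
  define z where "z = Complex (of_int x) (of_int y)"
  have gz: "gauss_int z" by (auto simp: z_def gauss_int_iff)
  have "z * cnj z = of_int (x\<^sup>2 + y\<^sup>2)"
    by (simp add: z_def complex_eq_iff power2_eq_square)
  also have "\<dots> = of_int (int p * k) - 1" unfolding k[symmetric] by simp
  finally have "of_int (int p) * of_int k - z * cnj z = 1" by simp
  then have "gram_rep (mat22 (of_int (int p)) z (cnj z) (of_int k))"
    using gz prime_gt_0_nat[OF assms] by (intro gram_rep_unimodular) auto
  then obtain C :: "complex^2^2" where C: "gmat C" "mat22 (of_nat p) z (cnj z) (of_int k) = C ** cadj C"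
    by (auto simp: gram_rep_def)
  have p: "of_nat p = C$1$1 * cnj (C$1$1) + C$1$2 * cnj (C$1$2)"
    using arg_cong[OF C(2), of "\<lambda>A. A$1$1"] by (simp add: matrix_matrix_mult_def sum_2)
  \<comment> \<open>Only the first row of \<open>C\<close> is used. Completed to the matrix of a
    quaternion, it yields two orthogonal rows of norm p.\<close>
  show ?thesis unfolding gram_rep_def
    by (rule exI[of _ "mat22 (C$1$1) (C$1$2) (- cnj (C$1$2)) (cnj (C$1$1))"])
      (use C(1) in \<open>simp add: gmat_mat22 gmat_nth mat22_mult cadj_mat22 p mult.commute add.commute\<close>)
qed

text \<open>The scalar form commutes with the factor \<open>C\<close> of the other form, so
  congruence by \<open>C\<close> turns it into the scaled form.\<close>

lemma gram_rep_scale: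
  assumes "gram_rep (mat22 m 0 0 m)" "gram_rep (mat22 a b c d)"
  shows "gram_rep (mat22 (m * a) (m * b) (m * c) (m * d))"
proof -
  obtain C :: "complex^2^2" where C: "gmat C" "mat22 a b c d = C ** cadj C"
    using assms by (auto simp: gram_rep_def)
  have "C ** mat22 m 0 0 m = mat22 m 0 0 m ** C"
    by (simp add: vec_eq_iff forall_2 matrix_matrix_mult_def sum_2)
  then have "C ** mat22 m 0 0 m ** cadj C = mat22 m 0 0 m ** mat22 a b c d"
    by (simp add: C(2) matrix_mul_assoc)
  then show ?thesis using gram_rep_conj[OF assms(1) C(1)] by (simp add: mat22_mult)
qed

text \<open>Lagrange's four-square theorem in matrix shape; its multiplicativity is
  \<open>gram_rep_scale\<close>.\<close>

lemma gram_rep_scalar: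
  assumes "n > 0"
  shows "gram_rep (mat22 (of_nat n) 0 0 (of_nat n))"
  using assms
proof (induction n rule: less_induct)
  case (less n)
  show ?case
  proof (cases "n = 1")
    case True
    have "gram_rep (mat 1)" unfolding gram_rep_def by (rule exI[of _ "mat 1"]) simp
    then show ?thesis by (simp add: True mat_1_mat22)
  next
    case False
    then obtain p where p: "prime p" "p dvd n" using prime_factor_nat by blast
    then obtain k where k: "n = p * k" by auto
    have "k > 0" "k < n" using k less.prems prime_gt_1_nat[OF p(1)] by auto
    then show ?thesis
      using gram_rep_scale[OF gram_rep_scalar_prime[OF p(1)] less.IH[of k]] by (simp add: k)
  qed
qed

section \<open>Descent on the determinant\<close>

text \<open>The row vector (- cnj b, a) is mapped by the form to (0, det), so dividing it by s and adjoining it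
  to the lattice keeps the form integral. The lattice grows unless s divides both a and cnj b.\<close>
lemma binary_form_descent:
  fixes a c :: int
  assumes a: "a > 0" and gb: "gauss_int b" and gs: "gauss_int s" "s \<noteq> 0"
    and det: "of_int a * of_int c - b * cnj b = s * cnj s"
    and ndvd: "\<not> (\<exists>k l. gauss_int k \<and> gauss_int l \<and> of_int a = s * k \<and> cnj b = s * l)"
  obtains T P a' b' c' \<mu> where "gmat T" "T ** P = mat 1"
    "P ** mat22 (of_int a) b (cnj b) (of_int c) ** cadj P = mat22 (of_int a') b' (cnj b') (of_int c')"
    "a' > 0" "gauss_int b'" "gauss_int \<mu>" "\<mu> \<noteq> 0" "gnorm \<mu> < gnorm s"
    "of_int a' * of_int c' - b' * cnj b' = \<mu> * cnj \<mu>"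
proof -
  let ?G = "mat22 (of_int a) b (cnj b) (of_int c)"
  obtain \<delta> x y \<alpha> \<beta> where bz: "gauss_int \<delta>" "gauss_int x" "gauss_int y" "gauss_int \<alpha>" "gauss_int \<beta>"
    "\<delta> \<noteq> 0" "of_int a = \<delta> * \<alpha>" "cnj b = \<delta> * \<beta>" "x * \<alpha> + y * \<beta> = 1"
    using gauss_int_bezout[of "of_int a" "cnj b"] a gb by (metis gauss_int_cnj gauss_int_of_int of_int_eq_0_iff less_irrefl)
  obtain \<mu> m n \<sigma> \<delta>' where bz2: "gauss_int \<mu>" "gauss_int m" "gauss_int n" "gauss_int \<sigma>" "gauss_int \<delta>'"
    "\<mu> \<noteq> 0" "s = \<mu> * \<sigma>" "\<delta> = \<mu> * \<delta>'" "m * \<sigma> + n * \<delta>' = 1"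
    using gauss_int_bezout[OF gs(1) bz(1)] gs(2) by metis
  have \<sigma>0: "\<sigma> \<noteq> 0" and \<delta>'0: "\<delta>' \<noteq> 0" using bz2 gs bz by auto
  \<comment> \<open>The source of all integrality below: multiplying by \<open>\<sigma>\<close>
    clears the denominator, and multiplying by \<open>\<delta>'\<close> leads back to the original
    data.\<close>
  have coprime: "gauss_int z" if "gauss_int (\<sigma> * z)" "gauss_int (\<delta>' * z)" for z
  proof -
    have "z = m * (\<sigma> * z) + n * (\<delta>' * z)"
      using bz2(9) by (metis mult.assoc distrib_right mult_1)
    then show ?thesis using that bz2 by (metis gauss_int_add gauss_int_mult)
  qed
  \<comment> \<open>The adjoined vector (- cnj b, a) / s is \<open>\<delta>'\<close> times (-
    \<beta>, \<alpha>) / \<sigma>. As \<open>\<delta>'\<close> and \<open>\<sigma>\<close> are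
    coprime, the enlarged lattice contains the latter vector, and (x, y) completes it to a basis.
    \<open>T\<close> expresses the old basis in the new one.\<close>
  define P where "P = mat22 (- \<beta> / \<sigma>) (\<alpha> / \<sigma>) x y"
  define T where "T = mat22 (- y * \<sigma>) \<alpha> (x * \<sigma>) \<beta>"
  define M where "M = P ** ?G ** cadj P"
  have a_cnj: "cnj \<delta> * cnj \<alpha> = \<delta> * \<alpha>"
    using bz(7) by (metis complex_cnj_mult complex_cnj_of_int)
  \<comment> \<open>The row (- \<beta>, \<alpha>) times the form is (0, t), and \<open>t\<close> is
    the determinant divided by \<open>\<delta>\<close>. This is why \<open>\<tau>\<close> = t /
    \<sigma> turns out integral.\<close>
  define t where "t = \<alpha> * of_int c - \<beta> * b"
  have gt: "gauss_int t" using bz gb by (simp add: t_def)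
  have \<delta>t: "\<delta> * t = s * cnj s"
    using det unfolding t_def bz(7,8) by (simp add: algebra_simps)
  define \<tau> where "\<tau> = t / \<sigma>"
  have \<sigma>\<tau>: "\<sigma> * \<tau> = t" using \<sigma>0 by (simp add: \<tau>_def)
  have "\<mu> * \<sigma> * (\<delta>' * \<tau>) = \<mu> * \<sigma> * cnj s"
    using \<delta>t unfolding bz2(8) \<sigma>\<tau>[symmetric] by (simp add: bz2(7) mult_ac)
  then have \<delta>'\<tau>: "\<delta>' * \<tau> = cnj s" using bz2(6) \<sigma>0 by simp
  have g\<tau>: "gauss_int \<tau>" by (rule coprime) (use gt gs in \<open>simp_all add: \<sigma>\<tau> \<delta>'\<tau>\<close>)
  have H: "cadj M = M" unfolding M_def by (simp add: cadj_mult cadj_mat22 matrix_mul_assoc)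
  have M: "M = mat22 (\<tau> * cnj \<alpha> / cnj \<sigma>) (\<tau> * cnj y)
      (cnj (\<tau> * cnj y))
      (x * of_int a * cnj x + y * cnj b * cnj x + x * b * cnj y + y * of_int c * cnj y)"
  proof -
    have r: "P ** ?G = mat22 0 \<tau> (x * of_int a + y * cnj b) (x * b + y * of_int c)"
      using \<sigma>0 by (simp add: P_def mat22_mult \<tau>_def t_def mat22_eq_iff field_simps bz(7,8))
    have M': "M = mat22 (\<tau> * cnj \<alpha> / cnj \<sigma>) (\<tau> * cnj y) (M$2$1)
      (x * of_int a * cnj x + y * cnj b * cnj x + x * b * cnj y + y * of_int c * cnj y)"
      unfolding mat22_eq_iff unfolding M_def r
      by (simp add: P_def cadj_mat22 mat22_mult algebra_simps)
    have "M$2$1 = cnj (M$1$2)" using arg_cong[OF H, of "\<lambda>A. A$2$1"] by simp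
    also have "M$1$2 = \<tau> * cnj y" using M' by (metis mat22_nth(2))
    finally show ?thesis using M' by simp
  qed
  have H: "cnj (M$i$i) = M$i$i" for i
    using arg_cong[OF H, of "\<lambda>A. A$i$i"] by simp
  define A where "A = \<tau> * cnj \<alpha> / cnj \<sigma>"
  have M11: "M$1$1 = A" by (simp add: M A_def)
  have Areal: "cnj A = A" using H[of 1] by (simp add: M11)
  have A\<delta>: "\<delta>' * (cnj \<delta>' * A) = of_int a"
  proof -
    have "\<delta>' * (cnj \<delta>' * A) = (\<delta>' * \<tau>) * cnj \<delta>' * cnj \<alpha> / cnj \<sigma>" by (simp add: A_def)
    also have "\<dots> = cnj \<delta> * cnj \<alpha>" unfolding \<delta>'\<tau> using \<sigma>0 by (simp add: bz2(7,8))
    finally show ?thesis by (simp add: a_cnj bz(7))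
  qed
  have A\<sigma>: "gauss_int (\<sigma> * A)"
  proof -
    have "cnj \<sigma> * A = \<tau> * cnj \<alpha>" using \<sigma>0 by (simp add: A_def)
    then have "gauss_int (cnj (cnj \<sigma> * A))" using g\<tau> bz by simp
    then show ?thesis by (simp add: Areal)
  qed
  \<comment> \<open>Two rounds of \<open>coprime\<close>: the first removes one factor of
    \<open>\<delta>' * cnj \<delta>'\<close>, the second the other. Conjugation in between is
    harmless because \<open>A\<close> is real.\<close>
  have "gauss_int (cnj \<delta>' * A)"
  proof (rule coprime)
    show "gauss_int (\<delta>' * (cnj \<delta>' * A))" unfolding A\<delta> by simp
    have "gauss_int (cnj \<delta>' * (\<sigma> * A))" using A\<sigma> bz2 by simp
    then show "gauss_int (\<sigma> * (cnj \<delta>' * A))" by (simp add: mult_ac)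
  qed
  then have "gauss_int (cnj (cnj \<delta>' * A))" by (rule gauss_int_cnj)
  then have "gauss_int (\<delta>' * A)" by (simp add: Areal)
  with A\<sigma> have "gauss_int A" by (rule coprime)
  then obtain a' where a': "A = of_int a'" using Areal by (rule gauss_int_real_is_int)
  have a'pos: "a' > 0"
  proof -
    have "complex_of_int (int (gnorm \<delta>') * a') = of_int a"
      using A\<delta> of_nat_gnorm[OF bz2(5)] by (simp add: a' mult_ac)
    then have "int (gnorm \<delta>') * a' = a" by (simp only: of_int_eq_iff)
    then show ?thesis using a by (metis of_nat_0_le_iff zero_less_mult_iff not_less)
  qed
  have "gauss_int (M$2$2)" using bz gb by (simp add: M)
  then obtain c' where c': "M$2$2 = of_int c'" using H by (rule gauss_int_real_is_int)
  define b' where "b' = \<tau> * cnj y"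
  have M': "M = mat22 (of_int a') b' (cnj b') (of_int c')"
    using M c' a' by (simp add: A_def b'_def)
  have "det P = - (x * \<alpha> + y * \<beta>) / \<sigma>"
    by (simp add: P_def det_2 diff_divide_distrib add_divide_distrib mult.commute)
  then have detP: "det P * \<sigma> = - 1" using \<sigma>0 bz(9) by simp
  have "det M = det P * (s * cnj s) * cnj (det P)"
    unfolding M_def det_mul det_cadj using det by (simp add: det_2)
  also have "\<dots> = \<mu> * cnj \<mu> * (det P * \<sigma>) * cnj (det P * \<sigma>)" by (simp add: bz2(7) mult_ac)
  finally have "det M = \<mu> * cnj \<mu>" by (simp add: detP)
  then have det': "of_int a' * of_int c' - b' * cnj b' = \<mu> * cnj \<mu>"
    by (simp add: M' det_2)
  have gT: "gmat T" using bz bz2 by (simp add: T_def gmat_mat22)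
  have TP: "T ** P = mat 1"
    using \<sigma>0 bz(9) by (simp add: T_def P_def mat22_mult mat_1_mat22 mult_ac add_ac)
  have "gnorm s = gnorm \<mu> * gnorm \<sigma>" using bz2 by (simp add: gnorm_mult)
  moreover have "gnorm \<sigma> \<noteq> 0" "gnorm \<mu> \<noteq> 0" using bz2 \<sigma>0 by (simp_all add: gnorm_eq_0_iff)
  \<comment> \<open>If \<open>\<sigma>\<close> were a unit, \<open>s\<close> would be associated to
    \<open>\<mu>\<close>, hence divide \<open>\<delta>\<close> and with it both \<open>a\<close> and
    \<open>cnj b\<close>.\<close>
  moreover have "gnorm \<sigma> \<noteq> 1"
  proof
    assume "gnorm \<sigma> = 1"
    then have u: "\<sigma> * cnj \<sigma> = 1" using of_nat_gnorm[OF bz2(4)] by simp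
    have "\<delta> * z = s * (cnj \<sigma> * \<delta>' * z)" for z
    proof -
      have "s * (cnj \<sigma> * \<delta>' * z) = (\<sigma> * cnj \<sigma>) * (\<mu> * \<delta>' * z)" by (simp add: bz2(7) mult_ac)
      then show ?thesis by (simp only: u bz2(8) mult_1_left)
    qed
    then have "of_int a = s * (cnj \<sigma> * \<delta>' * \<alpha>)" "cnj b = s * (cnj \<sigma> * \<delta>' * \<beta>)"
      by (simp_all only: bz(7,8))
    then show False using ndvd bz2 bz by (metis gauss_int_cnj gauss_int_mult)
  qed
  ultimately have "gnorm \<mu> < gnorm s" by (simp add: n_less_n_mult_m)
  then show ?thesis
    using that[OF gT TP _ a'pos _ bz2(1) bz2(6) _ det'] M' g\<tau> bz by (simp add: M_def b'_def)
qed

text \<open>The factor \<open>u\<close> is one of the four units, so \<open>s\<close> lies on an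
  axis or a diagonal of the plane. The diagonals come from the ramified prime 1 + i.\<close>

lemma gauss_int_conj_associated:
  assumes "gauss_int s" "s \<noteq> 0" "gauss_int u" "cnj s = s * u"
  obtains g :: nat and \<epsilon> where "g > 0" "gauss_int \<epsilon>" "\<epsilon> * cnj \<epsilon> = 1"
    "s = \<epsilon> * of_nat g \<or> s = \<epsilon> * (1 + \<i>) * of_nat g"
proof -
  obtain p q :: int where s: "s = Complex (of_int p) (of_int q)"
    using assms by (auto simp: gauss_int_iff)
  obtain m n :: int where u: "u = Complex (of_int m) (of_int n)"
    using assms by (auto simp: gauss_int_iff)
  have "real_of_int p = of_int (p * m - q * n)" "real_of_int (- q) = of_int (p * n + q * m)"
    using assms(4) by (simp_all add: s u complex_eq_iff)
  then have e: "p = p * m - q * n" "- q = p * n + q * m" by (simp_all only: of_int_eq_iff)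
  have "s * cnj s * (u * cnj u) = (s * u) * cnj (s * u)" by simp
  also have "\<dots> = s * cnj s" by (simp add: assms(4)[symmetric])
  finally have "u * cnj u = 1" using assms(2) by simp
  then have "real_of_int (m * m + n * n) = 1" by (simp add: u complex_eq_iff)
  then have "m * m + n * n = 1" by linarith
  then have mn: "m\<^sup>2 + n\<^sup>2 = 1" by (simp add: power2_eq_square)
  have sq: "z\<^sup>2 = 0 \<or> 1 \<le> z\<^sup>2" for z :: int using zero_le_power2[of z] by linarith
  have "(m = 0 \<and> (n = 1 \<or> n = - 1)) \<or> (n = 0 \<and> (m = 1 \<or> m = - 1))"
    using mn sq[of m] sq[of n] zero_le_power2[of m] zero_le_power2[of n] by (auto simp: power2_eq_1_iff)
  then have cases: "q = 0 \<or> p = 0 \<or> p = - q \<or> p = q" using e by auto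
  have pq: "p \<noteq> 0 \<or> q \<noteq> 0" using assms(2) by (auto simp: s complex_eq_iff)
  define r where "r = (if p = 0 then q else p)"
  \<comment> \<open>The value - i serves the diagonal p = - q, since 1 - i = - i (1 + i). The sign
    of \<open>r\<close> is moved into the unit afterwards.\<close>
  define v where "v = (if q = 0 then 1 else if p = 0 then \<i> else if p = q then 1 else - \<i>)"
  have r0: "r \<noteq> 0" using pq by (simp add: r_def)
  have sv: "s = v * of_int r \<or> s = v * (1 + \<i>) * of_int r"
    using cases pq by (auto simp: s v_def r_def complex_eq_iff)
  have rsgn: "(of_int r :: complex) = of_int (sgn r) * of_nat (nat \<bar>r\<bar>)"
    by (auto simp: sgn_if)
  show ?thesis
  proof (rule that[of "nat \<bar>r\<bar>" "v * of_int (sgn r)"])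
    show "nat \<bar>r\<bar> > 0" using r0 by simp
    show "gauss_int (v * of_int (sgn r))" by (simp add: v_def)
    show "v * of_int (sgn r) * cnj (v * of_int (sgn r)) = 1"
      using r0 by (auto simp: v_def sgn_if)
    show "s = v * of_int (sgn r) * of_nat (nat \<bar>r\<bar>) \<or> s = v * of_int (sgn r) * (1 + \<i>) * of_nat (nat \<bar>r\<bar>)"
      using sv unfolding rsgn by (simp add: mult_ac)
  qed
qed

text \<open>Descent is tried on the form and on its swap. If both fail, \<open>s\<close> divides
  every entry, so s^2 divides the determinant |s|^2; thus \<open>s\<close> divides
  \<open>cnj s\<close>, which leaves the two shapes of
  \<open>gauss_int_conj_associated\<close>.\<close>

lemma gram_rep_of_det_norm:
  fixes a c :: int
  assumes "a > 0" "gauss_int b" "gauss_int s" "s \<noteq> 0"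
    "of_int a * of_int c - b * cnj b = s * cnj s"
  shows "gram_rep (mat22 (of_int a) b (cnj b) (of_int c))"
  using assms
proof (induction "gnorm s" arbitrary: s a b c rule: less_induct)
  case less
  note a = less.prems(1) and gb = less.prems(2) and gs = less.prems(3,4) and det = less.prems(5)
  have descent: "gram_rep (mat22 (of_int a) b (cnj b) (of_int c))"
    if "a > 0" "gauss_int b" "of_int a * of_int c - b * cnj b = s * cnj s"
      "\<not> (\<exists>k l. gauss_int k \<and> gauss_int l \<and> of_int a = s * k \<and> cnj b = s * l)"
    for a c :: int and b
  proof (rule binary_form_descent[OF that(1,2) gs that(3,4)])
    fix T P a' b' c' \<mu>
    assume T: "gmat T" "T ** P = mat 1"
      and P: "P ** mat22 (of_int a) b (cnj b) (of_int c) ** cadj P = mat22 (of_int a') b' (cnj b') (of_int c')"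
      and h: "a' > 0" "gauss_int b'" "gauss_int \<mu>" "\<mu> \<noteq> 0"
        "of_int a' * of_int c' - b' * cnj b' = \<mu> * cnj \<mu>" and "gnorm \<mu> < gnorm s"
    have "gram_rep (mat22 (of_int a') b' (cnj b') (of_int c'))"
      using less.hyps[OF \<open>gnorm \<mu> < gnorm s\<close> h] .
    then show ?thesis using T by - (rule gram_rep_basis_change[of T P], simp_all add: P)
  qed
  \<comment> \<open>Positivity of \<open>c\<close> lets \<open>descent\<close> be applied to the
    swapped form.\<close>
  have "of_int (a * c) = (of_int (int (gnorm b + gnorm s)) :: complex)"
    using det of_nat_gnorm[OF gb] of_nat_gnorm[OF gs(1)] by (simp add: algebra_simps)
  then have "a * c = int (gnorm b + gnorm s)" by (simp only: of_int_eq_iff)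
  moreover have "gnorm s > 0" using gs gnorm_eq_0_iff by blast
  ultimately have c: "c > 0" using a by (smt (verit) zero_less_mult_pos of_nat_0_less_iff add_gr_0)
  show ?case
  proof (cases "\<exists>k l. gauss_int k \<and> gauss_int l \<and> of_int a = s * k \<and> cnj b = s * l")
    case False
    then show ?thesis using descent a gb det by blast
  next
    case 1: True
    show ?thesis
    proof (cases "\<exists>k l. gauss_int k \<and> gauss_int l \<and> of_int c = s * k \<and> cnj (cnj b) = s * l")
      case False
      then have "gram_rep (mat22 (of_int c) (cnj b) (cnj (cnj b)) (of_int a))"
        using c gb det by (intro descent) (simp_all add: mult.commute)
      then show ?thesis by - (rule gram_rep_swap, simp)
    next
      case True
      then obtain k3 k4 where k34: "gauss_int k3" "gauss_int k4" "of_int c = s * k3" "b = s * k4" by auto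
      obtain k1 k2 where k12: "gauss_int k1" "gauss_int k2" "of_int a = s * k1" "cnj b = s * k2" using 1 by auto
      have "s * cnj s = (s * k1) * (s * k3) - (s * k4) * (s * k2)"
        using det unfolding k12(3) k34(3) k12(4) unfolding k34(4)[symmetric] by simp
      then have "s * cnj s = s * (s * (k1 * k3 - k4 * k2))" by (simp add: algebra_simps)
      then have "cnj s = s * (k1 * k3 - k4 * k2)" using gs by simp
      then obtain g :: nat and \<epsilon> where g: "g > 0" "gauss_int \<epsilon>" "\<epsilon> * cnj \<epsilon> = 1"
        "s = \<epsilon> * of_nat g \<or> s = \<epsilon> * (1 + \<i>) * of_nat g"
        using gauss_int_conj_associated[OF gs, of "k1 * k3 - k4 * k2"] k12 k34 by auto
      have g0: "(of_nat g :: complex) \<noteq> 0" using g(1) by simp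
      \<comment> \<open>s divides the whole form: for real s divide it out and put it back with four squares;
        otherwise adjoin the first basis vector divided by 1 + i.\<close>
      from g(4) show ?thesis
      proof
        assume s: "s = \<epsilon> * of_nat g"
        obtain a' where a': "\<epsilon> * k1 = of_int a'"
        proof (rule gauss_int_real_is_int[of "\<epsilon> * k1"])
          show "gauss_int (\<epsilon> * k1)" using g k12 by simp
          have e: "\<epsilon> * k1 = of_int a / of_nat g" using g0 by (simp add: k12(3) s)
          show "cnj (\<epsilon> * k1) = \<epsilon> * k1" unfolding e by simp
        qed
        obtain c' where c': "\<epsilon> * k3 = of_int c'"
        proof (rule gauss_int_real_is_int[of "\<epsilon> * k3"])
          show "gauss_int (\<epsilon> * k3)" using g k34 by simp
          have e: "\<epsilon> * k3 = of_int c / of_nat g" using g0 by (simp add: k34(3) s)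
          show "cnj (\<epsilon> * k3) = \<epsilon> * k3" unfolding e by simp
        qed
        define b' where "b' = \<epsilon> * k4"
        have eq: "of_int a = of_nat g * (of_int a' :: complex)" "of_int c = of_nat g * (of_int c' :: complex)" "b = of_nat g * b'"
          unfolding k12(3) k34(3,4) s a'[symmetric] c'[symmetric] b'_def by (simp_all add: mult_ac)
        have "(of_nat g)\<^sup>2 * (of_int a' * of_int c' - b' * cnj b') = of_int a * of_int c - b * cnj b"
          unfolding eq by (simp add: algebra_simps power2_eq_square)
        also have "\<dots> = (of_nat g)\<^sup>2 * (\<epsilon> * cnj \<epsilon>)"
          unfolding det s by (simp add: power2_eq_square mult_ac)
        finally have d: "of_int a' * of_int c' - b' * cnj b' = 1" using g0 g(3) by simp
        have "complex_of_int a = of_int (int g * a')" by (simp add: eq)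
        then have "a = int g * a'" by (simp only: of_int_eq_iff)
        then have "a' > 0" using a g(1) by (simp add: zero_less_mult_iff)
        then have "gram_rep (mat22 (of_int a') b' (cnj b') (of_int c'))"
          using d g k34 by (intro gram_rep_unimodular) (auto simp: b'_def)
        then have "gram_rep (mat22 (of_nat g * of_int a') (of_nat g * b') (of_nat g * cnj b') (of_nat g * of_int c'))"
          using gram_rep_scale[OF gram_rep_scalar[OF g(1)]] by blast
        then show ?thesis by (simp add: eq)
      next
        assume s: "s = \<epsilon> * (1 + \<i>) * of_nat g"
        have i1: "(1 + \<i>) * (1 - \<i>) = 2" by (simp add: complex_eq_iff)
        have i0: "1 + \<i> \<noteq> 0" "1 - \<i> \<noteq> 0" using i1 by auto
        obtain x y :: int where xy: "\<epsilon> * k1 = Complex (of_int x) (of_int y)"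
          using g k12 by (metis gauss_int_iff gauss_int_mult)
        have ax: "of_int a = (1 + \<i>) * Complex (of_int x) (of_int y) * of_nat g"
          unfolding k12(3) s xy[symmetric] by (simp add: mult_ac)
        \<comment> \<open>Since \<open>a\<close> is real, y = - x, and \<open>a\<close> acquires a
          factor 2 = |1 + i|^2. This keeps the diagonal entry integral after division by 1 +
          i.\<close>
        have "Im (of_int a) = of_int (x + y) * real g" "Re (of_int a) = of_int (x - y) * real g"
          unfolding ax by (simp_all add: algebra_simps)
        then have "x + y = 0" "real_of_int a = of_int ((x - y) * int g)" using g(1) by (simp_all flip: of_int_add)
        then have y: "y = - x" and "a = (x - y) * int g" by (simp_all only: of_int_eq_iff)
        then have a2: "a = 2 * (x * int g)" by simp
        define a' where "a' = x * int g"
        have a': "a' > 0" using a by (simp add: a'_def a2)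
        define b' where "b' = \<epsilon> * of_nat g * k4"
        have b: "b = (1 + \<i>) * b'" unfolding k34(4) s b'_def by (simp add: mult_ac)
        \<comment> \<open>The determinant drops from |s|^2 = 2 g^2 to g^2, so the induction
          continues with \<open>g\<close> in place of \<open>s\<close>.\<close>
        have "2 * (of_int a' * of_int c - b' * cnj b') = of_int a * of_int c - b * cnj b"
          using i1 unfolding b a2 a'_def[symmetric] by (simp add: algebra_simps)
        also have "\<dots> = 2 * (of_nat g * cnj (of_nat g)) * (\<epsilon> * cnj \<epsilon>)"
          unfolding det s using i1 by (simp add: algebra_simps)
        finally have "2 * (of_int a' * of_int c - b' * cnj b') = 2 * (of_nat g * cnj (of_nat g))"
          by (simp only: g(3) mult_1_right)
        then have det': "of_int a' * of_int c - b' * cnj b' = of_nat g * cnj (of_nat g)"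
          by (rule mult_left_cancel[THEN iffD1, rotated]) simp
        have "complex_of_nat (gnorm s) = s * cnj s" using gs by (simp add: of_nat_gnorm)
        also have "\<dots> = 2 * of_nat (gnorm (of_nat g)) * (\<epsilon> * cnj \<epsilon>)"
          unfolding s of_nat_gnorm[OF gauss_int_of_nat] using i1 by (simp add: algebra_simps)
        finally have "complex_of_nat (gnorm s) = of_nat (2 * gnorm (of_nat g))" by (simp add: g(3))
        then have "gnorm s = 2 * gnorm (of_nat g)" by (simp only: of_nat_eq_iff)
        moreover have "gnorm (of_nat g) \<noteq> 0" using g0 by (simp add: gnorm_eq_0_iff)
        ultimately have "gram_rep (mat22 (of_int a') b' (cnj b') (of_int c))"
          using a' det' g0 g k34 by (intro less.hyps[of "of_nat g"]) (auto simp: b'_def)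
        moreover have "mat22 (1 / (1 + \<i>)) 0 0 1 ** mat22 (of_int a) b (cnj b) (of_int c) ** cadj (mat22 (1 / (1 + \<i>)) 0 0 1)
          = mat22 (of_int a') b' (cnj b') (of_int c)"
          using i0 i1 by (simp add: mat22_mult cadj_mat22 mat22_eq_iff b a2 a'_def mult.commute)
        ultimately show ?thesis
          using i0 by - (rule gram_rep_basis_change[of "mat22 (1 + \<i>) 0 0 1" "mat22 (1 / (1 + \<i>)) 0 0 1"],
            simp_all add: gmat_mat22 mat22_mult mat_1_mat22)
      qed
    qed
  qed
qed

section \<open>Triangularisation\<close>

lemma det_4:
  "det (A::'a::comm_ring_1^4^4) =
    A$1$1 * (A$2$2 * (A$3$3 * A$4$4 - A$3$4 * A$4$3) - A$2$3 * (A$3$2 * A$4$4 - A$3$4 * A$4$2)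
      + A$2$4 * (A$3$2 * A$4$3 - A$3$3 * A$4$2))
    - A$1$2 * (A$2$1 * (A$3$3 * A$4$4 - A$3$4 * A$4$3) - A$2$3 * (A$3$1 * A$4$4 - A$3$4 * A$4$1)
      + A$2$4 * (A$3$1 * A$4$3 - A$3$3 * A$4$1))
    + A$1$3 * (A$2$1 * (A$3$2 * A$4$4 - A$3$4 * A$4$2) - A$2$2 * (A$3$1 * A$4$4 - A$3$4 * A$4$1)
      + A$2$4 * (A$3$1 * A$4$2 - A$3$2 * A$4$1))
    - A$1$4 * (A$2$1 * (A$3$2 * A$4$3 - A$3$3 * A$4$2) - A$2$2 * (A$3$1 * A$4$3 - A$3$3 * A$4$1)
      + A$2$3 * (A$3$1 * A$4$2 - A$3$2 * A$4$1))"
proof -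
  have f1: "finite {2::4, 3, 4}" "1 \<notin> {2::4, 3, 4}" by auto
  have f2: "finite {3::4, 4}" "2 \<notin> {3::4, 4}" by auto
  have f3: "finite {4::4}" "3 \<notin> {4::4}" by auto
  show ?thesis
    unfolding det_def UNIV_4
    unfolding sum_over_permutations_insert[OF f1]
    unfolding sum_over_permutations_insert[OF f2]
    unfolding sum_over_permutations_insert[OF f3]
    unfolding permutes_sing
    by (simp add: sign_swap_id permutation_swap_id permutation_compose sign_compose sign_id swap_id_eq algebra_simps)
qed

section \<open>Unimodular row operations\<close>

definition two_row :: "'n \<Rightarrow> 'n \<Rightarrow> complex \<Rightarrow> complex \<Rightarrow> complex \<Rightarrow> complex \<Rightarrow> complex^'n^'n" where
  "two_row i j x y u v = (\<chi> r c. if r = i then (if c = i then x else if c = j then y else 0)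
     else if r = j then (if c = i then u else if c = j then v else 0)
     else if r = c then 1 else 0)"

lemma two_row_mult:
  assumes "i \<noteq> j"
  shows "(two_row i j x y u v ** A) $ r $ k =
    (if r = i then x * A$i$k + y * A$j$k else if r = j then u * A$i$k + v * A$j$k else A$r$k)"
proof -
  have comb: "(\<Sum>c\<in>UNIV. (if c = i then p else if c = j then q else 0) * A$c$k) = p * A$i$k + q * A$j$k" for p q
  proof -
    have "(\<Sum>c\<in>UNIV. (if c = i then p else if c = j then q else 0) * A$c$k)
      = (\<Sum>c\<in>UNIV. (if c = i then p * A$c$k else 0) + (if c = j then q * A$c$k else 0))"
      using assms by (intro sum.cong) auto
    then show ?thesis by (simp add: sum.distrib)
  qed
  have one: "(\<Sum>c\<in>UNIV. (if r = c then 1 else 0) * A$c$k) = A$r$k"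
    by (simp add: if_distrib[of "\<lambda>z. z * _"] cong: if_cong)
  show ?thesis
    using comb one by (simp add: matrix_matrix_mult_def two_row_def)
qed

lemma two_row_inverse:
  assumes "i \<noteq> j" "x * v - y * u = 1"
  shows "two_row i j x y u v ** two_row i j v (- y) (- u) x = mat 1"
  unfolding vec_eq_iff two_row_mult[OF assms(1)]
  using assms by (auto simp: two_row_def mat_def mult.commute)

lemma gmat_two_row:
  "gauss_int x \<Longrightarrow> gauss_int y \<Longrightarrow> gauss_int u \<Longrightarrow> gauss_int v \<Longrightarrow> gmat (two_row i j x y u v)"
  by (simp add: gmat_def two_row_def)

text \<open>Unimodularity is recorded by an integral inverse, since the inverse itself is used later
  as a basis.\<close>

definition row_equiv :: "complex^'m^'n \<Rightarrow> complex^'m^'n \<Rightarrow> bool" where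
  "row_equiv A B \<longleftrightarrow> (\<exists>U W. gmat U \<and> gmat W \<and> U ** W = mat 1 \<and> B = U ** A)"

lemma row_equiv_refl: "row_equiv A A"
  unfolding row_equiv_def by (rule exI[of _ "mat 1"])+ simp

lemma row_equiv_trans:
  assumes "row_equiv A B" "row_equiv B C"
  shows "row_equiv A C"
proof -
  obtain U W where 1: "gmat U" "gmat W" "U ** W = mat 1" "B = U ** A"
    using assms by (auto simp: row_equiv_def)
  obtain U' W' where 2: "gmat U'" "gmat W'" "U' ** W' = mat 1" "C = U' ** B"
    using assms by (auto simp: row_equiv_def)
  have "(U' ** U) ** (W ** W') = U' ** (U ** W) ** W'" by (simp add: matrix_mul_assoc)
  then have "(U' ** U) ** (W ** W') = mat 1" using 1 2 by simp
  moreover have "C = (U' ** U) ** A" by (simp add: 1 2 matrix_mul_assoc)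
  ultimately show ?thesis unfolding row_equiv_def using 1 2
    by (metis gmat_mult)
qed

text \<open>The Bezout data of the two entries form the block with rows (x, y) and (- b, a), of
  determinant 1. The last two conjuncts protect zeros created earlier.\<close>

lemma row_equiv_eliminate:
  assumes "gmat A" "i \<noteq> j"
  shows "\<exists>B. row_equiv A B \<and> gmat B \<and> B$j$k = 0 \<and> (\<forall>r. r \<noteq> i \<longrightarrow> r \<noteq> j \<longrightarrow> B$r = A$r) \<and>
    (\<forall>c. A$i$c = 0 \<longrightarrow> A$j$c = 0 \<longrightarrow> B$i$c = 0 \<and> B$j$c = 0)"
proof (cases "A$i$k = 0 \<and> A$j$k = 0")
  case True
  then show ?thesis using assms row_equiv_refl by blast
next
  case False
  obtain g x y a b where g: "gauss_int x" "gauss_int y" "gauss_int a" "gauss_int b"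
    "A$i$k = g * a" "A$j$k = g * b" "x * a + y * b = 1"
    using gauss_int_bezout[of "A$i$k" "A$j$k"] False gmat_nth[OF assms(1)] by metis
  let ?E = "two_row i j x y (- b) a"
  have gE: "gmat ?E" using g by (simp add: gmat_two_row)
  show ?thesis
  proof (intro exI[of _ "?E ** A"] conjI allI impI)
    show "row_equiv A (?E ** A)"
      unfolding row_equiv_def using gE g assms(2)
      by (intro exI[of _ ?E] exI[of _ "two_row i j a (- y) b x"])
        (use two_row_inverse[OF assms(2), of x a y "- b"] in \<open>simp add: gmat_two_row\<close>)
    show "gmat (?E ** A)" using gE assms(1) by simp
    show "(?E ** A) $ j $ k = 0" using assms(2) g by (simp add: two_row_mult)
    show "(?E ** A) $ r = A $ r" if "r \<noteq> i" "r \<noteq> j" for r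
      using that assms(2) by (simp add: vec_eq_iff two_row_mult)
    show "(?E ** A) $ i $ c = 0" "(?E ** A) $ j $ c = 0" if "A$i$c = 0" "A$j$c = 0" for c
      using that assms(2) by (simp_all add: two_row_mult)
  qed
qed

lemma row_equiv_triangular:
  fixes A :: "complex^4^4"
  assumes "gmat A"
  obtains B where "row_equiv A B" "B$2$1 = 0" "B$3$1 = 0" "B$4$1 = 0" "B$3$2 = 0" "B$4$2 = 0" "B$4$3 = 0"
proof -
  obtain A1 where 1: "row_equiv A A1" "gmat A1" "A1$2$1 = 0"
    using row_equiv_eliminate[OF assms, of 1 2 1] by auto
  obtain A2 where 2: "row_equiv A1 A2" "gmat A2" "A2$3$1 = 0" "A2$2 = A1$2"
    using row_equiv_eliminate[OF 1(2), of 1 3 1] by auto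
  obtain A3 where 3: "row_equiv A2 A3" "gmat A3" "A3$4$1 = 0" "A3$2 = A2$2" "A3$3 = A2$3"
    using row_equiv_eliminate[OF 2(2), of 1 4 1] by auto
  have z3: "A3$2$1 = 0" "A3$3$1 = 0" "A3$4$1 = 0" using 1 2 3 by auto
  obtain A4 where 4: "row_equiv A3 A4" "gmat A4" "A4$3$2 = 0" "A4$4 = A3$4"
    "A4$2$1 = 0 \<and> A4$3$1 = 0"
    using row_equiv_eliminate[OF 3(2), of 2 3 2] z3 by auto
  obtain A5 where 5: "row_equiv A4 A5" "gmat A5" "A5$4$2 = 0" "A5$3 = A4$3"
    "A5$2$1 = 0 \<and> A5$4$1 = 0"
    using row_equiv_eliminate[OF 4(2), of 2 4 2] 4 z3 by auto
  have z5: "A5$3$1 = 0" "A5$4$1 = 0" "A5$3$2 = 0" "A5$4$2 = 0" using 4 5 by auto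
  obtain A6 where 6: "row_equiv A5 A6" "A6$4$3 = 0" "A6$2 = A5$2"
    "A6$3$1 = 0 \<and> A6$4$1 = 0" "A6$3$2 = 0 \<and> A6$4$2 = 0"
    using row_equiv_eliminate[OF 5(2), of 3 4 3] z5
    by auto
  have "row_equiv A A6" using 1 2 3 4 5 6 by (blast intro: row_equiv_trans)
  then show ?thesis using that 6 5 by auto
qed

section \<open>The orthogonal complement of an icube\<close>

text \<open>The columns of V with index in J form an icube and the others vanish. The rows of U with index
  outside J are (up to conjugation) a basis of the orthogonal complement, with Gram matrix the
  corresponding block of S; the dual lattice scaled by lam has Gram matrix the same block of Q.\<close>
locale padded_icube =
  fixes V U W :: "complex^4^4" and lam :: real and J :: "4 set"
  assumes lam: "lam > 0"
    and V: "gmat V" and U: "gmat U" and W: "gmat W" and UW: "U ** W = mat 1"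
    and VV: "\<And>i j. (cadj V ** V)$i$j = (if i = j \<and> i \<in> J then of_real lam else 0)"
    and V0: "\<And>r c. c \<notin> J \<Longrightarrow> V$r$c = 0"
    and UV0: "\<And>r c. r \<notin> J \<Longrightarrow> (U ** V)$r$c = 0"
begin

definition "R = U ** V"
definition "S = U ** cadj U"
text \<open>\<open>lam\<close> times the orthogonal projection onto the complement of the icube:
  unlike the projection it is integral. \<open>Q\<close> is the same Hermitian form in the basis
  given by the columns of \<open>W\<close>.\<close>

definition "P = (\<chi> i j. (if i = j then of_real lam else 0) - (V ** cadj V)$i$j)"
definition "Q = cadj W ** P ** W"

lemma WU: "W ** U = mat 1"
  using UW matrix_left_right_inverse by blast

lemma gauss_int_lam:
  assumes "i \<in> J"
  shows "gauss_int (of_real lam)"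
proof -
  have "gauss_int ((cadj V ** V)$i$i)" using V by (intro gmat_nth) simp
  then show ?thesis using assms by (simp add: VV)
qed

lemma gmat_Q: "J \<noteq> {} \<Longrightarrow> gmat Q"
proof -
  assume "J \<noteq> {}"
  then have "gauss_int (of_real lam)" using gauss_int_lam by blast
  moreover have "gmat (V ** cadj V)" using V by simp
  ultimately have "gmat P" by (simp add: P_def gmat_def)
  then show ?thesis using W by (simp add: Q_def)
qed

lemma cadj_Q: "cadj Q = Q"
proof -
  have "cadj (V ** cadj V) = V ** cadj V" by (simp add: cadj_mult)
  then have "cnj ((V ** cadj V)$j$i) = (V ** cadj V)$i$j" for i j by (metis cadj_nth)
  then have "cadj P = P" by (simp add: P_def vec_eq_iff)
  then show ?thesis by (simp add: Q_def cadj_mult matrix_mul_assoc)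
qed

lemma cadj_S: "cadj S = S"
  by (simp add: S_def cadj_mult)

lemma P_mult: "(P ** A)$i$j = of_real lam * A$i$j - (V ** cadj V ** A)$i$j"
proof -
  have "(P ** A)$i$j = (\<Sum>k\<in>UNIV. P$i$k * A$k$j)"
    by (subst matrix_matrix_mult_def) simp
  also have "\<dots> = (\<Sum>k\<in>UNIV. (if i = k then of_real lam * A$k$j else 0) - (V ** cadj V)$i$k * A$k$j)"
    by (intro sum.cong) (auto simp: P_def left_diff_distrib)
  also have "\<dots> = of_real lam * A$i$j - (\<Sum>k\<in>UNIV. (V ** cadj V)$i$k * A$k$j)"
    by (simp add: sum_subtractf)
  finally show ?thesis by (simp add: matrix_matrix_mult_def[of "V ** cadj V"])
qed

lemma P_V: "P ** V = 0"
proof -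
  have "(V ** cadj V ** V)$i$j = of_real lam * V$i$j" for i j
  proof -
    have "(V ** cadj V ** V)$i$j = (\<Sum>k\<in>UNIV. V$i$k * (cadj V ** V)$k$j)"
      unfolding matrix_mul_assoc[symmetric] by (subst matrix_matrix_mult_def) simp
    also have "\<dots> = (\<Sum>k\<in>UNIV. if k = j then of_real lam * V$i$k else 0)"
      by (intro sum.cong) (auto simp: VV V0)
    finally show ?thesis by simp
  qed
  then show ?thesis by (simp add: vec_eq_iff P_mult)
qed

lemma Q_R: "Q ** R = 0"
proof -
  have "Q ** R = cadj W ** (P ** ((W ** U) ** V))"
    by (simp add: Q_def R_def matrix_mul_assoc)
  also have "\<dots> = cadj W ** 0" by (simp add: WU P_V)
  also have "\<dots> = 0" by (simp add: vec_eq_iff matrix_matrix_mult_def)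
  finally show ?thesis .
qed

text \<open>For an index outside \<open>J\<close> the column of \<open>cadj U\<close> is orthogonal
  to the icube, so \<open>P\<close> merely multiplies it by \<open>lam\<close>.\<close>

lemma Q_S:
  assumes "j \<notin> J"
  shows "(Q ** S)$i$j = (if i = j then of_real lam else 0)"
proof -
  have "(P ** cadj U)$r$j = of_real lam * cadj U$r$j" for r
  proof -
    have "V ** cadj V ** cadj U = V ** cadj (U ** V)" by (simp add: cadj_mult matrix_mul_assoc)
    then have "(V ** cadj V ** cadj U)$r$j = 0"
      using assms by (simp add: matrix_matrix_mult_def[of V] UV0)
    then show ?thesis by (simp add: P_mult)
  qed
  then have "(cadj W ** (P ** cadj U))$i$j = of_real lam * (cadj W ** cadj U)$i$j"
    by (simp add: matrix_matrix_mult_def[of "cadj W"] sum_distrib_left mult_ac)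
  moreover have "cadj W ** cadj U = mat 1" using UW cadj_mult[of U W] by simp
  moreover have "Q ** S = cadj W ** (P ** cadj U)"
  proof -
    have "Q ** S = cadj W ** P ** (W ** U) ** cadj U" by (simp add: Q_def S_def matrix_mul_assoc)
    then show ?thesis by (simp add: WU matrix_mul_assoc)
  qed
  ultimately show ?thesis by (simp add: mat_def)
qed

text \<open>The nonzero columns of \<open>V\<close> are orthogonal, hence independent, and
  \<open>U\<close> is invertible. This yields nonzero diagonal entries once \<open>R\<close> is
  triangular.\<close>

lemma R_kernel:
  assumes "R *v c = 0" "k \<in> J"
  shows "c$k = 0"
proof -
  have "V *v c = W *v (R *v c)"
    by (simp add: R_def matrix_vector_mul_assoc matrix_mul_assoc WU)
  then have "V *v c = 0" using assms by simp
  then have "(cadj V ** V) *v c = 0" by (simp flip: matrix_vector_mul_assoc)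
  moreover have "(A *v c)$k = (\<Sum>j\<in>UNIV. A$k$j * c$j)" for A :: "complex^4^4"
    by (simp add: matrix_vector_mult_def)
  ultimately have "0 = (\<Sum>j\<in>UNIV. (cadj V ** V)$k$j * c$j)"
    by (metis zero_index)
  also have "\<dots> = (\<Sum>j\<in>UNIV. if j = k then of_real lam * c$j else 0)"
    using assms(2) by (intro sum.cong) (auto simp: VV)
  finally show ?thesis using lam by simp
qed

lemma norm_det_U: "det U * cnj (det U) = 1"
proof -
  have "det U * det W = 1" using UW by (metis det_I det_mul)
  then have "gnorm (det U) * gnorm (det W) = 1"
    using gnorm_mult[of "det U" "det W"] U W by (simp add: gauss_int_det gnorm_def)
  then have "gnorm (det U) = 1" by simp
  then show ?thesis using of_nat_gnorm[of "det U"] U by (simp add: gauss_int_det)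
qed

text \<open>The volume count. Let \<open>B\<close> consist of the icube columns and, outside
  \<open>J\<close>, the conjugated rows of \<open>U\<close>. The left side is |det (U B)|^2 and the
  right side |det B|^2, the Gram matrix of \<open>B\<close> being block diagonal by orthogonality;
  det U has absolute value 1.\<close>

lemma det_identity:
  "det (\<chi> i j. if j \<in> J then R$i$j else S$i$j) * cnj (det (\<chi> i j. if j \<in> J then R$i$j else S$i$j))
    = det (\<chi> i j. if i \<in> J \<or> j \<in> J then if i = j then of_real lam else 0 else S$i$j)"
    (is "det ?M * _ = det ?N")
proof -
  define B where "B = (\<chi> i j. if j \<in> J then V$i$j else cnj (U$j$i))"
  have "U ** B = ?M"
    by (simp add: vec_eq_iff B_def R_def S_def matrix_matrix_mult_def)
  then have M: "det ?M = det U * det B" by (metis det_mul)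
  have "cadj B ** B = ?N"
  proof -
    have "(cadj B ** B)$i$j = ?N$i$j" for i j
    proof (cases "i \<in> J")
      case i: True
      show ?thesis
      proof (cases "j \<in> J")
        case True
        then have "(cadj B ** B)$i$j = (cadj V ** V)$i$j" using i by (simp add: B_def matrix_matrix_mult_def)
        then show ?thesis using i VV by simp
      next
        case False
        then have "(cadj B ** B)$i$j = cnj ((U ** V)$j$i)"
          using i by (simp add: B_def matrix_matrix_mult_def mult.commute)
        then show ?thesis using i False by (auto simp: UV0)
      qed
    next
      case i: False
      show ?thesis
      proof (cases "j \<in> J")
        case True
        then have "(cadj B ** B)$i$j = (U ** V)$i$j" using i by (simp add: B_def matrix_matrix_mult_def)
        then show ?thesis using i True by (auto simp: UV0)
      next
        case False
        then show ?thesis using i by (simp add: B_def S_def matrix_matrix_mult_def)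
      qed
    qed
    then show ?thesis by (simp add: vec_eq_iff)
  qed
  then have "det ?N = cnj (det B) * det B" by (metis det_mul det_cadj)
  moreover have "det ?M * cnj (det ?M) = (det U * cnj (det U)) * (cnj (det B) * det B)"
    unfolding M by (simp add: mult_ac)
  ultimately show ?thesis by (simp add: norm_det_U)
qed

end

section \<open>Filling the complement for two and three given columns\<close>

context padded_icube
begin

lemma Q_R_entry: "Q$i$1 * R$1$k + Q$i$2 * R$2$k + Q$i$3 * R$3$k + Q$i$4 * R$4$k = 0"
  using arg_cong[OF Q_R, of "\<lambda>A. A$i$k"] by (simp add: matrix_matrix_mult_def sum_4)

lemma Q_S_entry:
  assumes "j \<notin> J"
  shows "Q$i$1 * S$1$j + Q$i$2 * S$2$j + Q$i$3 * S$3$j + Q$i$4 * S$4$j = (if i = j then of_real lam else 0)"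
  using Q_S[OF assms, of i] by (simp add: matrix_matrix_mult_def sum_4)

lemma R_zero: "r \<notin> J \<Longrightarrow> R$r$c = 0"
  by (simp add: R_def UV0)

text \<open>A vanishing diagonal entry would make the leading columns of the triangular
  \<open>R\<close> dependent. The test vectors here and in the next two lemmas are the resulting
  relations.\<close>

lemma R_11: "1 \<in> J \<Longrightarrow> R$2$1 = 0 \<Longrightarrow> R$3$1 = 0 \<Longrightarrow> R$4$1 = 0 \<Longrightarrow> R$1$1 \<noteq> 0"
  using R_kernel[of "\<chi> i. if i = 1 then 1 else 0" 1]
  by (auto simp: vec_eq_iff forall_4 matrix_vector_mult_def sum_4)

lemma R_22:
  assumes "2 \<in> J" "R$2$1 = 0" "R$3$1 = 0" "R$4$1 = 0" "R$3$2 = 0" "R$4$2 = 0" "R$1$1 \<noteq> 0"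
  shows "R$2$2 \<noteq> 0"
  using R_kernel[of "\<chi> i. if i = 1 then R$1$2 else if i = 2 then - R$1$1 else 0" 2] assms
  by (auto simp: vec_eq_iff forall_4 matrix_vector_mult_def sum_4)

lemma R_33:
  assumes "3 \<in> J" "R$2$1 = 0" "R$3$1 = 0" "R$4$1 = 0" "R$3$2 = 0" "R$4$2 = 0" "R$4$3 = 0"
    "R$1$1 \<noteq> 0" "R$2$2 \<noteq> 0"
  shows "R$3$3 \<noteq> 0"
  using R_kernel[of "\<chi> i. if i = 1 then R$1$2 * R$2$3 - R$1$3 * R$2$2
      else if i = 2 then - R$1$1 * R$2$3 else if i = 3 then R$1$1 * R$2$2 else 0" 3] assms
  by (auto simp: vec_eq_iff forall_4 matrix_vector_mult_def sum_4 algebra_simps)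

lemma Q_sym: "Q$i$j = cnj (Q$j$i)"
  using arg_cong[OF cadj_Q, of "\<lambda>A. A$i$j"] by simp

lemma S_sym: "S$i$j = cnj (S$j$i)"
  using arg_cong[OF cadj_S, of "\<lambda>A. A$i$j"] by simp

text \<open>As \<open>R\<close> is triangular with nonzero diagonal, \<open>Q ** R = 0\<close> kills
  the first two columns of \<open>Q\<close>, leaving G H = lam on the lower blocks. The volume count
  reads |s|^2 (det H)^2 = lam^2 det H, whence det G = |s|^2.\<close>

lemma orthogonal_pair:
  assumes J: "J = {1, 2}" and R21: "R$2$1 = 0"
  shows "\<exists>Z::complex^2^4. gmat Z \<and> cadj Z ** Z = mat22 (of_real lam) 0 0 (of_real lam) \<and> cadj V ** Z = 0"
proof -
  let ?l = "complex_of_real lam"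
  have R0: "R$3$c = 0" "R$4$c = 0" for c by (simp_all add: R_zero J)
  have R11: "R$1$1 \<noteq> 0" by (rule R_11) (simp_all add: J R21 R0)
  have R22: "R$2$2 \<noteq> 0" by (rule R_22) (simp_all add: J R21 R0 R11)
  have Q1: "Q$i$1 = 0" for i using Q_R_entry[of i 1] R11 by (simp add: R21 R0)
  have Q2: "Q$i$2 = 0" for i using Q_R_entry[of i 2] R22 by (simp add: Q1 R0)
  define G where "G = mat22 (Q$3$3) (Q$3$4) (Q$4$3) (Q$4$4)"
  define H where "H = mat22 (S$3$3) (S$3$4) (S$4$3) (S$4$4)"
  have GH: "G ** H = mat22 ?l 0 0 ?l"
    using Q_S_entry[of 3 3] Q_S_entry[of 3 4] Q_S_entry[of 4 3] Q_S_entry[of 4 4]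
    by (simp add: G_def H_def mat22_mult J Q1 Q2)
  then have dGH: "det G * det H = ?l\<^sup>2"
    by (simp flip: det_mul) (simp add: det_2 power2_eq_square)
  have dH: "det H = S$3$3 * S$4$4 - S$3$4 * S$4$3" by (simp add: H_def det_2)
  have dHreal: "cnj (det H) = det H"
    unfolding dH by (simp add: S_sym[symmetric] mult.commute)
  define s where "s = R$1$1 * R$2$2"
  have gR: "gmat R" using U V by (simp add: R_def)
  have gs: "gauss_int s" "s \<noteq> 0" using R11 R22 gR by (simp_all add: s_def gmat_nth)
  have dH0: "det H \<noteq> 0" using dGH lam by auto
  have "(s * det H) * cnj (s * det H) = ?l\<^sup>2 * det H"
    using det_identity unfolding J det_4 dH s_def
    by (simp add: R21 R0 power2_eq_square mult.assoc)
  then have "det H * (det H * (s * cnj s)) = det H * (det G * det H)"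
    by (simp add: dHreal dGH mult_ac)
  then have dG: "det G = s * cnj s" using dH0 by simp
  have gQ: "gmat Q" using gmat_Q J by simp
  obtain a where a: "Q$3$3 = of_int a"
    using gauss_int_real_is_int[OF gmat_nth[OF gQ, of 3 3]] Q_sym[of 3 3] by metis
  obtain c where c: "Q$4$4 = of_int c"
    using gauss_int_real_is_int[OF gmat_nth[OF gQ, of 4 4]] Q_sym[of 4 4] by metis
  define b where "b = Q$3$4"
  have G: "G = mat22 (of_int a) b (cnj b) (of_int c)"
    by (simp add: G_def a c b_def Q_sym[of 4 3])
  \<comment> \<open>Cramer's rule gives |s|^2 S44 = lam a, and S44 is the squared length of a row of
    the invertible matrix \<open>U\<close>.\<close>
  have a0: "a > 0"
  proof -
    have l1: "Q$3$3 * S$3$3 + Q$3$4 * S$4$3 = ?l" and l2: "Q$3$3 * S$3$4 + Q$3$4 * S$4$4 = 0"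
      using Q_S_entry[of 3 3] Q_S_entry[of 4 3] by (simp_all add: J Q1 Q2)
    have "of_int a * det H = (Q$3$3 * S$3$3 + Q$3$4 * S$4$3) * S$4$4 - (Q$3$3 * S$3$4 + Q$3$4 * S$4$4) * S$4$3"
      unfolding a[symmetric] dH by (simp add: algebra_simps)
    then have adH: "of_int a * det H = ?l * S$4$4" by (simp only: l1 l2) simp
    have "s * cnj s * (of_int a * det H) = (det G * det H) * of_int a" by (simp add: dG mult_ac)
    then have e: "s * cnj s * S$4$4 = ?l * of_int a"
      using lam by (simp add: adH dGH power2_eq_square mult.assoc)
    have S44: "S$4$4 = of_real (\<Sum>k\<in>UNIV. (cmod (U$4$k))\<^sup>2)"
      by (simp add: S_def matrix_matrix_mult_def complex_norm_square del: of_real_power)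
    have "complex_of_real ((cmod s)\<^sup>2 * (\<Sum>k\<in>UNIV. (cmod (U$4$k))\<^sup>2)) = of_real (lam * of_int a)"
      using e unfolding S44 by (simp add: complex_norm_square del: of_real_power of_real_sum)
    then have e': "(cmod s)\<^sup>2 * (\<Sum>k\<in>UNIV. (cmod (U$4$k))\<^sup>2) = lam * of_int a"
      by (simp only: of_real_eq_iff)
    have "(\<Sum>k\<in>UNIV. (cmod (U$4$k))\<^sup>2) \<ge> 0" by (intro sum_nonneg) auto
    then have "lam * of_int a \<ge> 0" unfolding e'[symmetric] by simp
    then have "a \<ge> 0" using lam by (simp add: zero_le_mult_iff)
    moreover have "a \<noteq> 0"
    proof
      assume "a = 0"
      then have "S$4$4 = 0" using e gs by simp
      then have "(\<Sum>k\<in>UNIV. (cmod (U$4$k))\<^sup>2) = 0" unfolding S44 by (simp only: of_real_eq_0_iff)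
      then have "U$4$k = 0" for k by (simp add: sum_nonneg_eq_0_iff)
      then have "(U ** W)$4$4 = 0" by (simp add: matrix_matrix_mult_def)
      then show False by (simp add: UW mat_def)
    qed
    ultimately show ?thesis by simp
  qed
  have "gram_rep G" unfolding G
  proof (rule gram_rep_of_det_norm[OF a0 _ gs])
    show "gauss_int b" using gQ by (simp add: b_def gmat_nth)
    show "of_int a * of_int c - b * cnj b = s * cnj s"
      using dG by (simp add: G det_2)
  qed
  then obtain C :: "complex^2^2" where C: "gmat C" "G = C ** cadj C" by (auto simp: gram_rep_def)
  have comm: "A ** mat22 z 0 0 z = mat22 z 0 0 z ** A" for A :: "complex^2^2" and z
    by (simp add: vec_eq_iff forall_2 matrix_matrix_mult_def sum_2)
  have linv: "mat22 ?l 0 0 ?l ** mat22 (1 / ?l) 0 0 (1 / ?l) = mat 1"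
    "mat22 (1 / ?l) 0 0 (1 / ?l) ** mat22 ?l 0 0 ?l = mat 1"
    using lam by (simp_all add: mat22_mult mat_1_mat22)
  \<comment> \<open>A one-sided inverse of a square matrix is two-sided; this moves \<open>C\<close>
    from the left of \<open>cadj C ** H\<close> to its right.\<close>
  have "C ** (cadj C ** H ** mat22 (1 / ?l) 0 0 (1 / ?l)) = mat 1"
    using GH linv(1) by (simp add: C(2) matrix_mul_assoc)
  then have "(cadj C ** H ** mat22 (1 / ?l) 0 0 (1 / ?l)) ** C = mat 1"
    using matrix_left_right_inverse by blast
  then have "cadj C ** H ** C ** mat22 (1 / ?l) 0 0 (1 / ?l) = mat 1"
    by (metis comm matrix_mul_assoc)
  then have CHC: "cadj C ** H ** C = mat22 ?l 0 0 ?l"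
    by (metis linv(2) matrix_mul_assoc matrix_mul_lid matrix_mul_rid)
  \<comment> \<open>The conjugated last two rows of \<open>U\<close> as columns: a basis of the
    complement with Gram matrix \<open>H\<close>.\<close>
  define X :: "complex^2^4" where "X = (\<chi> k j. cnj (U$(if j = 1 then 3 else 4)$k))"
  have XX: "cadj X ** X = H"
    unfolding H_def mat22_eq_iff by (simp add: X_def S_def matrix_matrix_mult_def)
  have VX: "cadj V ** X = 0"
  proof -
    have "(cadj V ** X)$i$j = cnj (R$(if j = 1 then 3 else 4)$i)" for i j
      by (simp add: X_def R_def matrix_matrix_mult_def mult.commute)
    then show ?thesis by (simp add: vec_eq_iff R0)
  qed
  show ?thesis
  proof (intro exI[of _ "X ** C"] conjI)
    show "gmat (X ** C)" using C(1) U by (intro gmat_mult) (simp_all add: X_def gmat_def)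
    have "cadj (X ** C) ** (X ** C) = cadj C ** (cadj X ** X) ** C" by (simp add: cadj_mult matrix_mul_assoc)
    then show "cadj (X ** C) ** (X ** C) = mat22 ?l 0 0 ?l" by (simp add: XX CHC)
    have "cadj V ** (X ** C) = 0 ** C" by (simp add: matrix_mul_assoc VX)
    then show "cadj V ** (X ** C) = 0" by (simp add: vec_eq_iff matrix_matrix_mult_def)
  qed
qed

text \<open>Here the complement has rank 1 and g h = lam. The volume count |r|^2 h^2 = lam^3 h
  becomes |r|^2 = g lam^2, so \<open>g\<close> is the norm of r / lam and thus of some Gaussian
  integer \<open>s\<close>. Scaling the generator by \<open>s\<close> gives norm g h.\<close>

lemma orthogonal_vector:
  assumes J: "J = {1, 2, 3}" and tri: "R$2$1 = 0" "R$3$1 = 0" "R$3$2 = 0"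
  shows "\<exists>z::complex^4. (\<forall>k. gauss_int (z$k)) \<and> (\<Sum>k\<in>UNIV. cnj (z$k) * z$k) = of_real lam
    \<and> (\<forall>j. (\<Sum>k\<in>UNIV. cnj (V$k$j) * z$k) = 0)"
proof -
  let ?l = "complex_of_real lam"
  have l0: "?l \<noteq> 0" using lam by simp
  have R0: "R$4$c = 0" for c by (simp add: R_zero J)
  have R11: "R$1$1 \<noteq> 0" by (rule R_11) (simp_all add: J tri R0)
  have R22: "R$2$2 \<noteq> 0" by (rule R_22) (simp_all add: J tri R0 R11)
  have R33: "R$3$3 \<noteq> 0" by (rule R_33) (simp_all add: J tri R0 R11 R22)
  have Q1: "Q$i$1 = 0" for i using Q_R_entry[of i 1] R11 by (simp add: tri R0)
  have Q2: "Q$i$2 = 0" for i using Q_R_entry[of i 2] R22 by (simp add: Q1 tri R0)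
  have Q3: "Q$i$3 = 0" for i using Q_R_entry[of i 3] R33 by (simp add: Q1 Q2 R0)
  define g h r where "g = Q$4$4" and "h = S$4$4" and "r = R$1$1 * R$2$2 * R$3$3"
  have gh: "g * h = ?l"
    using Q_S_entry[of 4 4] by (simp add: J Q1 Q2 Q3 g_def h_def)
  have h0: "h \<noteq> 0" using gh l0 by auto
  have hreal: "cnj h = h" unfolding h_def by (rule S_sym[symmetric])
  have "(r * h) * cnj (r * h) = ?l * ?l * ?l * h"
    using det_identity unfolding J det_4 r_def h_def
    by (simp add: tri R0 mult.assoc)
  then have "h * (h * (r * cnj r)) = h * (?l * (?l * ?l))"
    by (simp add: hreal mult_ac)
  then have "h * (r * cnj r) = g * h * (?l * cnj ?l)" using h0 by (simp add: gh)
  then have "h * (r * cnj r) = h * (g * (?l * cnj ?l))" by (simp only: mult_ac)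
  then have r: "r * cnj r = g * (?l * cnj ?l)" using h0 by simp
  have gR: "gmat R" using U V by (simp add: R_def)
  have gr: "gauss_int r" using gR by (simp add: r_def gmat_nth)
  have gg: "gauss_int g" using gmat_Q J by (simp add: g_def gmat_nth)
  have gl: "gauss_int ?l" using gauss_int_lam[of 1] J by simp
  obtain s where s: "gauss_int s" "g = s * cnj s"
    using norm_quotient_is_norm[OF gr gl l0 gg r] .
  have hU: "h = (\<Sum>k\<in>UNIV. U$4$k * cnj (U$4$k))"
    by (simp add: h_def S_def matrix_matrix_mult_def)
  show ?thesis
  proof (intro exI[of _ "\<chi> k. cnj (U$4$k) * s"] conjI allI)
    fix k show "gauss_int ((\<chi> k. cnj (U$4$k) * s)$k)" using U s by (simp add: gmat_nth)
  next
    have "(\<Sum>k\<in>UNIV. cnj ((\<chi> k. cnj (U$4$k) * s)$k) * (\<chi> k. cnj (U$4$k) * s)$k) = g * h"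
      by (simp add: hU s sum_distrib_left mult_ac)
    then show "(\<Sum>k\<in>UNIV. cnj ((\<chi> k. cnj (U$4$k) * s)$k) * (\<chi> k. cnj (U$4$k) * s)$k) = ?l"
      using gh by simp
  next
    fix j
    have "(\<Sum>k\<in>UNIV. cnj (V$k$j) * (\<chi> k. cnj (U$4$k) * s)$k) = s * cnj (R$4$j)"
      by (simp add: R_def matrix_matrix_mult_def sum_distrib_left mult_ac)
    then show "(\<Sum>k\<in>UNIV. cnj (V$k$j) * (\<chi> k. cnj (U$4$k) * s)$k) = 0" by (simp add: R0)
  qed
qed

end

section \<open>Extension of icubes\<close>

text \<open>In the type \<open>4\<close> the numeral 4 equals 0. It is placed last here, so that the
  first k positions correspond to the indices 1, ..., k.\<close>

definition pos4 :: "4 \<Rightarrow> nat" where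
  "pos4 i = (if i = 1 then 0 else if i = 2 then 1 else if i = 3 then 2 else 3)"

lemma pos4_simps [simp]: "pos4 1 = 0" "pos4 2 = 1" "pos4 3 = 2" "pos4 4 = 3"
  by (simp_all add: pos4_def)

lemma pos4_less: "pos4 i < 4"
  by (simp add: pos4_def)

lemma pos4_eq_iff [simp]: "pos4 i = pos4 j \<longleftrightarrow> i = j"
  using exhaust_4[of i] exhaust_4[of j] by auto

lemma sum_pos4: "(\<Sum>r\<in>UNIV. f (pos4 r)) = (\<Sum>i<4. f i)" for f :: "nat \<Rightarrow> complex"
  by (simp add: sum_4 eval_nat_numeral)

lemma hprod_4: "length v = 4 \<Longrightarrow> hprod v w = (\<Sum>r\<in>UNIV. cnj (v ! pos4 r) * w ! pos4 r)"
  unfolding hprod_def using sum_pos4[of "\<lambda>i. cnj (v ! i) * w ! i"] by simp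

lemma hprod_flip: "length v = length w \<Longrightarrow> hprod w v = cnj (hprod v w)"
  by (simp add: hprod_def mult.commute)

definition list4 :: "complex^4 \<Rightarrow> complex list" where
  "list4 z = [z$1, z$2, z$3, z$4]"

lemma length_list4 [simp]: "length (list4 z) = 4"
  by (simp add: list4_def)

lemma list4_nth: "list4 z ! pos4 i = z$i"
  using exhaust_4[of i] by (auto simp: list4_def eval_nat_numeral)

lemma gauss_int_list4: "(\<forall>k. gauss_int (z$k)) \<Longrightarrow> x \<in> set (list4 z) \<Longrightarrow> gauss_int x"
  by (auto simp: list4_def)

lemma hprod_list4: "length v = 4 \<Longrightarrow> hprod v (list4 z) = (\<Sum>r\<in>UNIV. cnj (v ! pos4 r) * z$r)"
  by (simp add: hprod_4 list4_nth)

lemma icube_snoc: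
  assumes "icube n k lam A" "k < n" "length z = n" "\<forall>x\<in>set z. gauss_int x"
    "hprod z z = of_real lam" "\<And>i. i < k \<Longrightarrow> hprod (A ! i) z = 0"
  shows "icube n (Suc k) lam (A @ [z])"
proof -
  have len: "length A = k" and lA: "\<And>i. i < k \<Longrightarrow> length (A ! i) = n"
    using assms(1) by (auto simp: icube_def)
  have "hprod z (A ! i) = 0" if "i < k" for i
    using hprod_flip[of "A ! i" z] lA[OF that] assms(3,6) that by simp
  then show ?thesis using assms len
    by (auto simp: icube_def nth_append less_Suc_eq)
qed

text \<open>Zero columns keep all matrices of size 4 by 4 whatever k is.\<close>

lemma icube_padded:
  assumes "icube 4 k lam A"
  obtains V U W :: "complex^4^4" where "padded_icube V U W lam {c. pos4 c < k}"
    "\<forall>r c. pos4 c < k \<longrightarrow> V$r$c = A ! pos4 c ! pos4 r"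
    "(U ** V)$2$1 = 0" "(U ** V)$3$1 = 0" "(U ** V)$3$2 = 0"
proof -
  define V :: "complex^4^4" where "V = (\<chi> r c. if pos4 c < k then A ! pos4 c ! pos4 r else 0)"
  have A: "lam > 0" "length A = k" "\<And>i. i < k \<Longrightarrow> length (A ! i) = 4"
    "\<And>i j. i < k \<Longrightarrow> j < k \<Longrightarrow> hprod (A ! i) (A ! j) = (if i = j then of_real lam else 0)"
    using assms by (auto simp: icube_def)
  have gA: "gauss_int (A ! i ! j)" if "i < k" "j < 4" for i j
  proof -
    have "A ! i \<in> set A" "A ! i ! j \<in> set (A ! i)" using that A by simp_all
    then show ?thesis using assms unfolding icube_def by blast
  qed
  have gV: "gmat V" using gA by (simp add: V_def gmat_def pos4_less)
  obtain B where B: "row_equiv V B" "B$2$1 = 0" "B$3$1 = 0" "B$4$1 = 0" "B$3$2 = 0" "B$4$2 = 0" "B$4$3 = 0"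
    using row_equiv_triangular[OF gV] .
  obtain U W where UW: "gmat U" "gmat W" "U ** W = mat 1" "B = U ** V"
    using B(1) by (auto simp: row_equiv_def)
  have V0: "V$r$c = 0" if "\<not> pos4 c < k" for r c using that by (simp add: V_def)
  have B0: "B$r$c = 0" if "\<not> pos4 c < k" for r c
    using V0[OF that] by (simp add: UW matrix_matrix_mult_def)
  have "padded_icube V U W lam {c. pos4 c < k}"
  proof
    fix i j
    show "(cadj V ** V)$i$j = (if i = j \<and> i \<in> {c. pos4 c < k} then of_real lam else 0)"
    proof (cases "pos4 i < k \<and> pos4 j < k")
      case True
      then have "(cadj V ** V)$i$j = hprod (A ! pos4 i) (A ! pos4 j)"
        using A by (simp add: hprod_4 matrix_matrix_mult_def V_def)
      then show ?thesis using True A(4) by simp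
    next
      case False
      then show ?thesis by (auto simp: matrix_matrix_mult_def V_def)
    qed
  next
    fix r c assume r: "r \<notin> {c. pos4 c < k}"
    show "(U ** V)$r$c = 0"
    proof (cases "pos4 c < k")
      case False
      then show ?thesis using B0 UW by simp
    next
      case True
      \<comment> \<open>Rows outside the index set lie below the diagonal in every genuine column;
        the padding columns vanish anyway.\<close>
      then have "pos4 c < pos4 r" using r by simp
      then have "B$r$c = 0" using B exhaust_4[of r] exhaust_4[of c] by auto
      then show ?thesis using UW by simp
    qed
  qed (use A gV UW V0 in auto)
  then show ?thesis using that[of V U W] B UW by (simp add: V_def)
qed

lemma icube_3_extend:
  assumes "icube 4 3 lam A"
  shows "\<exists>C. icube 4 4 lam (A @ C)"
proof -
  obtain V U W :: "complex^4^4" where p: "padded_icube V U W lam {c. pos4 c < 3}"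
    and VA: "\<forall>r c. pos4 c < 3 \<longrightarrow> V$r$c = A ! pos4 c ! pos4 r"
    and tri: "(U ** V)$2$1 = 0" "(U ** V)$3$1 = 0" "(U ** V)$3$2 = 0"
    using icube_padded[OF assms] by blast
  interpret padded_icube V U W lam "{c. pos4 c < 3}" by (rule p)
  have J: "{c. pos4 c < 3} = {1, 2, 3}"
    unfolding set_eq_iff forall_4 by simp
  obtain z where z: "\<forall>k. gauss_int (z$k)" "(\<Sum>k\<in>UNIV. cnj (z$k) * z$k) = of_real lam"
    "\<And>j. (\<Sum>k\<in>UNIV. cnj (V$k$j) * z$k) = 0"
    using orthogonal_vector[OF J] tri unfolding R_def by blast
  have lA: "\<And>i. i < 3 \<Longrightarrow> length (A ! i) = 4" using assms by (auto simp: icube_def)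
  have orth: "hprod (A ! pos4 j) (list4 z) = 0" if "pos4 j < 3" for j
    using z(3)[of j] that by (simp add: hprod_list4 lA VA)
  have "icube 4 (Suc 3) lam (A @ [list4 z])"
  proof (rule icube_snoc[OF assms])
    show "hprod (list4 z) (list4 z) = of_real lam" by (simp add: hprod_list4 list4_nth z)
    fix i :: nat assume "i < 3"
    then have "i = pos4 1 \<or> i = pos4 2 \<or> i = pos4 3" by auto
    then show "hprod (A ! i) (list4 z) = 0" using orth \<open>i < 3\<close> by blast
  qed (use gauss_int_list4 z in auto)
  then show ?thesis by auto
qed

lemma icube_2_extend:
  assumes "icube 4 2 lam A"
  shows "\<exists>C. icube 4 4 lam (A @ C)"
proof -
  obtain V U W :: "complex^4^4" where p: "padded_icube V U W lam {c. pos4 c < 2}"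
    and VA: "\<forall>r c. pos4 c < 2 \<longrightarrow> V$r$c = A ! pos4 c ! pos4 r"
    and tri: "(U ** V)$2$1 = 0" "(U ** V)$3$1 = 0" "(U ** V)$3$2 = 0"
    using icube_padded[OF assms] by blast
  interpret padded_icube V U W lam "{c. pos4 c < 2}" by (rule p)
  have J: "{c. pos4 c < 2} = {1, 2}"
    unfolding set_eq_iff forall_4 by simp
  obtain Z :: "complex^2^4" where Z: "gmat Z" "cadj Z ** Z = mat22 (of_real lam) 0 0 (of_real lam)"
    "cadj V ** Z = 0"
    using orthogonal_pair[OF J] tri unfolding R_def by blast
  define z where "z j = list4 (\<chi> k. Z$k$j)" for j
  have lz [simp]: "length (z j) = 4" for j by (simp add: z_def)
  have zz: "hprod (z i) (z j) = (cadj Z ** Z)$i$j" for i j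
    by (simp add: z_def hprod_list4 list4_nth matrix_matrix_mult_def)
  have gz: "\<forall>x\<in>set (z j). gauss_int x" for j
    unfolding z_def using gauss_int_list4[of "\<chi> k. Z$k$j"] Z(1) by (simp add: gmat_nth)
  have lA: "length A = 2" "\<And>i. i < 2 \<Longrightarrow> length (A ! i) = 4" using assms by (auto simp: icube_def)
  have orth: "hprod (A ! pos4 i) (z j) = 0" if "pos4 i < 2" for i j
  proof -
    have "hprod (A ! pos4 i) (z j) = (cadj V ** Z)$i$j"
      using that by (simp add: z_def hprod_list4 lA VA matrix_matrix_mult_def)
    then show ?thesis by (simp add: Z(3))
  qed
  have orth': "hprod (A ! i) (z j) = 0" if "i < 2" for i j
  proof -
    have "i = pos4 1 \<or> i = pos4 2" using that by auto
    then show ?thesis using orth that by blast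
  qed
  have "icube 4 (Suc 2) lam (A @ [z 1])"
    using orth' gz by (intro icube_snoc[OF assms]) (simp_all add: zz Z(2))
  then have "icube 4 (Suc (Suc 2)) lam ((A @ [z 1]) @ [z 2])"
  proof (rule icube_snoc)
    fix i :: nat assume "i < Suc 2"
    then show "hprod ((A @ [z 1]) ! i) (z 2) = 0"
      using orth' lA by (auto simp: nth_append less_Suc_eq zz Z(2))
  qed (use gz in \<open>simp_all add: zz Z(2)\<close>)
  then show ?thesis by auto
qed

lemma icube_1_extend:
  assumes "icube 4 1 lam A"
  shows "\<exists>C. icube 4 4 lam (A @ C)"
proof -
  obtain v where A: "A = [v]" and v: "length v = 4" "\<forall>x\<in>set v. gauss_int x" "hprod v v = of_real lam"
    using assms by (auto simp: icube_def length_Suc_conv)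
  obtain a b c d where abcd: "v = [a, b, c, d]"
    using v(1) by (auto simp: length_Suc_conv eval_nat_numeral)
  have "icube 4 (Suc 1) lam (A @ [[- cnj b, cnj a, - cnj d, cnj c]])"
    by (rule icube_snoc[OF assms]) (use v(2,3) in \<open>auto simp: A abcd hprod_def algebra_simps eval_nat_numeral\<close>)
  then obtain C where "icube 4 4 lam ((A @ [[- cnj b, cnj a, - cnj d, cnj c]]) @ C)"
    using icube_2_extend by (metis Suc_1)
  then show ?thesis by auto
qed

theorem mainTheorem5:
  fixes k :: nat and lam :: real and A :: "complex list list"
  assumes "1 \<le> k" and "k \<le> 4" and "icube 4 k lam A"
  shows "extends_to 4 4 lam A"
proof -
  have "k = 1 \<or> k = 2 \<or> k = 3 \<or> k = 4" using assms by auto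
  \<comment> \<open>For k = 4 the list \<open>C\<close> is empty. New columns are always appended,
    so the identity embeds \<open>A\<close>.\<close>
  then obtain C where C: "icube 4 4 lam (A @ C)"
    using assms(3) icube_1_extend icube_2_extend icube_3_extend by (metis append_Nil2)
  moreover have "length A \<le> 4" using assms by (simp add: icube_def)
  ultimately show ?thesis unfolding extends_to_def
    by (intro exI[of _ "A @ C"] conjI exI[of _ id]) (auto simp: nth_append)
qed

end
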